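(* Let $M>0$, let $F\in H^2(T_{\Gamma_1},M)$, and let $S_m(F)=\sum_{k=1}^m\langle F,\mathcal B_k\rangle\mathcal B_k$ correspond to a sequence $\{z^{(k)}\}_{k=1}^m\subset T_{\Gamma_1}$ each element of which is selected according to the maximal selection principle, i.e. for every $0\le k<m$, $$|\langle F,\mathcal B_{k+1}^{z^{(k+1)}}\rangle|=\max_{z\in T_{\Gamma_1}}|\langle F,\mathcal B_{k+1}^{z}\rangle| .$$ Then $$\|F-S_m(F)\|\le\frac{M}{\sqrt{m+1}} .$$
   Context: $\Gamma_1=\{y\in\mathbb R^n: y_1>0,\dots,y_n>0\}$ and $T_{\Gamma_1}=\{x+iy: x\in\mathbb R^n,\ y\in\Gamma_1\}\subset\mathbb C^n$. $H^2(T_{\Gamma_1})$ is the space of holomorphic $F$ on $T_{\Gamma_1}$ with $\|F\|^2=\sup_{y\in\Gamma_1}\int_{\mathbb R^n}|F(x+iy)|^2dx<\infty$; it is a Hilbert space with inner product $\langle F,G\rangle=\int_{\mathbb R^n}F(\xi)\overline{G(\xi)}\,d\xi$, where $F(\xi)=\lim_{\eta\in\Gamma_1,\eta\to0}F(\xi+i\eta)$ denotes the $L^2$ boundary limit. Its reproducing kernel is $K_{\Gamma_1}(w,\overline z)=\prod_{k=1}^n\frac{-1}{2\pi i(w_k-\overline z_k)}$; put $\phi_z=K_{\Gamma_1}(\cdot,\overline z)$. Function class: $$H^2(T_{\Gamma_1},M)=\Big\{F\in H^2(T_{\Gamma_1}): F=\sum_{j=1}^\infty c_j\frac{\phi_{w^{(j)}}}{\|\phi_{w^{(j)}}\|},\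 w^{(j)}\in T_{\Gamma_1},\ \sum_{j=1}^\infty|c_j|\le M\Big\}.$$ Multiple kernels: fix a direction $\vec d=(d_1,\dots,d_n)\in\mathbb C^n$ with $\sum_j|d_j|^2=1$ and put $\vec d\cdot\nabla=\sum_{j=1}^n d_j\frac{\partial}{\partial\overline z_j}$. For a sequence $(z^{(1)},z^{(2)},\dots)$ in $T_{\Gamma_1}$ (repetitions allowed) let $l_k$ be the cardinality of $\{j\le k: z^{(j)}=z^{(k)}\}$ and $\Phi_{z^{(k)}}=\frac1{(l_k-1)!}(\vec d\cdot\nabla)^{l_k-1}\phi_z|_{z=z^{(k)}}$. $\{\mathcal B_k\}$ is the orthonormal system obtained by applying the Gram-Schmidt process (with normalization) to $\Phi_{z^{(1)}},\Phi_{z^{(2)}},\dots$. Given $z^{(1)},\dots,z^{(k)}$ and $z\in T_{\Gamma_1}$, $\mathcal B_{k+1}^z$ denotes the last element of the Gram-Schmidt orthonormalization of $\{\mathcal B_1,\dots,\mathcal B_k,\Phi_z\}$, where $\Phi_z$ is the multiple kernel associated with the last term of the sequence $(z^{(1)},\dots,z^{(k)},z)$; thus $\mathcal B_{k+1}=\mathcal B_{k+1}^{z^{(k+1)}}$. *)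

theory Defs
  imports "HOL-Analysis.Analysis"
begin

definition first_octant :: "(real ^ 'n) set" where
  "first_octant = {y. \<forall>k. y $ k > 0}"

definition cpoint :: "real ^ 'n \<Rightarrow> real ^ 'n \<Rightarrow> complex ^ 'n" where
  "cpoint x y = (\<chi> k. Complex (x $ k) (y $ k))"

definition tube :: "(complex ^ 'n) set" where
  "tube = {cpoint x y | x y. y \<in> first_octant}"

text \<open>Holomorphy in several variables: the real Frechet derivative exists and is complex linear.\<close>

definition holomorphic_several :: "(complex ^ 'n::finite \<Rightarrow> complex) \<Rightarrow> (complex ^ 'n) set \<Rightarrow> bool" where
  "holomorphic_several F S \<longleftrightarrow>
     (\<forall>z\<in>S. \<exists>F'. (F has_derivative F') (at z within S) \<and> (\<forall>c v. F' (c *s v) = c * F' v))"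

text \<open>Elements of the Hardy space are represented by total functions; only their values on the
  tube matter, for membership, norm and inner product alike.\<close>

definition hardy_norm_sq :: "(complex ^ 'n::finite \<Rightarrow> complex) \<Rightarrow> ennreal" where
  "hardy_norm_sq F =
     (SUP y\<in>first_octant. \<integral>\<^sup>+ x. ennreal ((cmod (F (cpoint x y)))\<^sup>2) \<partial>lborel)"

definition hardy_space :: "(complex ^ 'n::finite \<Rightarrow> complex) set" where
  "hardy_space = {F. holomorphic_several F tube \<and> hardy_norm_sq F < \<infinity>}"

definition hardy_norm :: "(complex ^ 'n::finite \<Rightarrow> complex) \<Rightarrow> real" where
  "hardy_norm F = sqrt (enn2real (hardy_norm_sq F))"

definition is_boundary_limit ::
    "(complex ^ 'n::finite \<Rightarrow> complex) \<Rightarrow> (real ^ 'n \<Rightarrow> complex) \<Rightarrow> bool" where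
  "is_boundary_limit F f \<longleftrightarrow>
     f \<in> borel_measurable lborel \<and>
     (\<integral>\<^sup>+ x. ennreal ((cmod (f x))\<^sup>2) \<partial>lborel) < \<infinity> \<and>
     ((\<lambda>\<eta>. \<integral>\<^sup>+ x. ennreal ((cmod (F (cpoint x \<eta>) - f x))\<^sup>2) \<partial>lborel) \<longlongrightarrow> 0)
       (at 0 within first_octant)"

text \<open>The boundary limit is unique only almost everywhere; the inner product does not depend on
  the representative chosen here.\<close>

definition boundary_limit :: "(complex ^ 'n::finite \<Rightarrow> complex) \<Rightarrow> real ^ 'n \<Rightarrow> complex" where
  "boundary_limit F = (SOME f. is_boundary_limit F f)"

definition hardy_inner ::
    "(complex ^ 'n::finite \<Rightarrow> complex) \<Rightarrow> (complex ^ 'n \<Rightarrow> complex) \<Rightarrow> complex" where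
  "hardy_inner F G = (LINT \<xi>|lborel. boundary_limit F \<xi> * cnj (boundary_limit G \<xi>))"

definition kernel :: "complex ^ 'n::finite \<Rightarrow> complex ^ 'n \<Rightarrow> complex" where
  "kernel z w = (\<Prod>k\<in>UNIV. - 1 / (2 * of_real pi * \<i> * (w $ k - cnj (z $ k))))"

text \<open>The series for \<open>F\<close> converges in the norm of the Hardy space.\<close>

definition hardy_class :: "real \<Rightarrow> (complex ^ 'n::finite \<Rightarrow> complex) set" where
  "hardy_class M = {F \<in> hardy_space. \<exists>(c :: nat \<Rightarrow> complex) (w :: nat \<Rightarrow> complex ^ 'n).
     (\<forall>j. w j \<in> tube) \<and>
     (\<lambda>N. hardy_norm (\<lambda>v. F v -
        (\<Sum>j<N. c j * (kernel (w j) v / of_real (hardy_norm (kernel (w j))))))) \<longlonglongrightarrow> 0 \<and>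
     summable (\<lambda>j. cmod (c j)) \<and> (\<Sum>j. cmod (c j)) \<le> M}"

text \<open>The Wirtinger derivative with respect to the conjugate of the \<open>j\<close>-th variable.\<close>

definition wirtinger_bar :: "'n \<Rightarrow> (complex ^ 'n::finite \<Rightarrow> complex) \<Rightarrow> complex ^ 'n \<Rightarrow> complex" where
  "wirtinger_bar j g z =
     (vector_derivative (\<lambda>t::real. g (z + t *\<^sub>R axis j 1)) (at 0) +
      \<i> * vector_derivative (\<lambda>t::real. g (z + t *\<^sub>R axis j \<i>)) (at 0)) / 2"

definition dir_nabla ::
    "complex ^ 'n::finite \<Rightarrow> (complex ^ 'n \<Rightarrow> complex) \<Rightarrow> complex ^ 'n \<Rightarrow> complex" where
  "dir_nabla d g z = (\<Sum>j\<in>UNIV. d $ j * wirtinger_bar j g z)"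

text \<open>Sequences are indexed from 0, so \<open>z k\<close> is the \<open>k + 1\<close>-st point; likewise for
  the multiple kernels and the orthonormal system.\<close>

definition multiplicity_at :: "(nat \<Rightarrow> 'a) \<Rightarrow> nat \<Rightarrow> nat" where
  "multiplicity_at z k = card {j. j \<le> k \<and> z j = z k}"

definition multiple_kernel ::
    "complex ^ 'n::finite \<Rightarrow> (nat \<Rightarrow> complex ^ 'n) \<Rightarrow> nat \<Rightarrow> complex ^ 'n \<Rightarrow> complex" where
  "multiple_kernel d z k w =
     1 / fact (multiplicity_at z k - 1) *
     (dir_nabla d ^^ (multiplicity_at z k - 1)) (\<lambda>u. kernel u w) (z k)"

fun gram_schmidt ::
    "(nat \<Rightarrow> complex ^ 'n::finite \<Rightarrow> complex) \<Rightarrow> nat \<Rightarrow> complex ^ 'n \<Rightarrow> complex" where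
  "gram_schmidt f k =
     (let g = (\<lambda>w. f k w - (\<Sum>j<k. hardy_inner (f k) (gram_schmidt f j) * gram_schmidt f j w))
      in (\<lambda>w. g w / of_real (hardy_norm g)))"

declare gram_schmidt.simps [simp del]

definition basis_fun ::
    "complex ^ 'n::finite \<Rightarrow> (nat \<Rightarrow> complex ^ 'n) \<Rightarrow> nat \<Rightarrow> complex ^ 'n \<Rightarrow> complex" where
  "basis_fun d z = gram_schmidt (multiple_kernel d z)"

text \<open>\<open>trial_fun d z k u\<close> is the last element of the orthonormalization of the first \<open>k\<close>
  basis functions followed by the multiple kernel of the last term of
  \<open>z 0, \<dots>, z (k - 1), u\<close>.\<close>

definition trial_fun ::
    "complex ^ 'n::finite \<Rightarrow> (nat \<Rightarrow> complex ^ 'n) \<Rightarrow> nat \<Rightarrow> complex ^ 'n \<Rightarrow> complex ^ 'n \<Rightarrow> complex" where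
  "trial_fun d z k u =
     gram_schmidt (\<lambda>j. if j < k then basis_fun d z j else multiple_kernel d (z(k := u)) k) k"

definition partial_sum ::
    "complex ^ 'n::finite \<Rightarrow> (nat \<Rightarrow> complex ^ 'n) \<Rightarrow> (complex ^ 'n \<Rightarrow> complex) \<Rightarrow> nat \<Rightarrow>
     complex ^ 'n \<Rightarrow> complex" where
  "partial_sum d z F m w = (\<Sum>k<m. hardy_inner F (basis_fun d z k) * basis_fun d z k w)"

definition maximal_selection ::
    "complex ^ 'n::finite \<Rightarrow> (nat \<Rightarrow> complex ^ 'n) \<Rightarrow> (complex ^ 'n \<Rightarrow> complex) \<Rightarrow> nat \<Rightarrow> bool" where
  "maximal_selection d z F m \<longleftrightarrow>
     (\<forall>k<m. \<forall>u\<in>tube. cmod (hardy_inner F (trial_fun d z k u))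
                     \<le> cmod (hardy_inner F (trial_fun d z k (z k))))"

end

theory Submission
  imports Defs "HOL-Complex_Analysis.Cauchy_Integral_Formula"
begin

text \<open>The estimate is the one for the orthogonal greedy algorithm. Let \<open>R\<^sub>k = F - S\<^sub>k(F)\<close> and let
  \<open>a\<^sub>k\<close> be the modulus of the coefficient of \<open>F\<close> at the next basis function. The residual is
  orthogonal to the earlier basis functions, and orthogonal projection shortens the kernels, so
  the maximal selection principle gives \<open>\<bar>\<langle>R\<^sub>k, e\<rangle>\<bar> \<le> a\<^sub>k\<close> for every normalized kernel \<open>e\<close>.
  Expanding \<open>F\<close> in normalized kernels, \<open>\<parallel>R\<^sub>k\<parallel>\<^sup>2 = \<langle>R\<^sub>k, F\<rangle> \<le> M a\<^sub>k\<close>, while the next norm square is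
  \<open>\<parallel>R\<^sub>k\<parallel>\<^sup>2 - a\<^sub>k\<^sup>2\<close>; this recursion forces \<open>\<parallel>R\<^sub>m\<parallel>\<^sup>2 \<le> M\<^sup>2 / (m + 1)\<close>.

  The analytic input is that the norm, a supremum over the tube, equals the \<open>L\<^sup>2\<close> norm of the
  boundary limit. Only limits of combinations of multiple kernels are needed. These kernels are
  holomorphic across the boundary, so the Poisson formula in one coordinate at a time shows that the
  \<open>L\<^sup>2\<close> norm of a slice is at most that of the boundary values, and the general case follows by
  completeness of \<open>L\<^sup>2\<close>.\<close>

section \<open>The Poisson formula for the half-plane\<close>

text \<open>The inner product integrates an arbitrarily chosen boundary limit, while the norm is a
  supremum over slices. Linking the two on the whole Hardy space would call for its Fourier
  description. Instead the argument lives in \<open>hardy_closure\<close>, the norm closure of the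
  functions in \<open>decaying\<close>: these extend past the real boundary and have a square
  integrable majorant in the real part that is uniform in the imaginary part. Kernels, their
  derivatives, everything Gram-Schmidt makes of them, and F itself lie in that closure, where
  boundary limits exist and Hilbert space arguments apply.

  The comparison of trial functions with kernels is a short chain. Let R be the residual of F and T
  the residual of the kernel at u. Then R pairs with the kernel as it pairs with T, because R is
  orthogonal to what was subtracted; and R pairs with T as F does, because T is orthogonal as well.
  Dividing by the smaller norm of T can only increase the value. At a point chosen before, the trial
  function comes from a derivative of the kernel and the chain breaks; there R is orthogonal to the
  kernel, so the left-hand side is 0.\<close>

definition poisson :: "real \<Rightarrow> real \<Rightarrow> real" where
  "poisson y t = y / (pi * (t\<^sup>2 + y\<^sup>2))"

lemma poisson_nonneg: "y > 0 \<Longrightarrow> 0 \<le> poisson y t"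
  by (simp add: poisson_def)

lemma continuous_on_poisson: "y > 0 \<Longrightarrow> continuous_on A (poisson y)"
  unfolding poisson_def[abs_def]
  by (intro continuous_intros) (auto simp: sum_power2_eq_zero_iff)

lemma borel_measurable_poisson [measurable]: "poisson y \<in> borel_measurable borel"
  unfolding poisson_def[abs_def] by measurable

text \<open>The primitive \<open>arctan (t / y) / pi\<close> climbs from -1/2 to 1/2. Since the
  integrand is nonnegative, the fundamental theorem on the whole line yields integrability together
  with the value.\<close>

lemma has_bochner_integral_poisson:
  assumes "y > 0"
  shows "has_bochner_integral lborel (poisson y) 1"
proof -
  have deriv: "((\<lambda>t. arctan (t / y) / pi) has_real_derivative poisson y t) (at t)" for t
  proof -
    have "((\<lambda>t. arctan (t / y) / pi) has_real_derivative (1 / y / (1 + (t / y)\<^sup>2)) / pi) (at t)"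
      using assms by (auto intro!: derivative_eq_intros simp: divide_inverse mult_ac)
    moreover have "1 + (t / y)\<^sup>2 = (t\<^sup>2 + y\<^sup>2) / y\<^sup>2"
      using assms by (simp add: field_simps)
    then have "(1 / y / (1 + (t / y)\<^sup>2)) / pi = poisson y t"
      using assms by (simp add: poisson_def power2_eq_square)
    ultimately show ?thesis by simp
  qed
  have cont: "isCont (poisson y) t" for t
    using continuous_on_poisson[OF assms, of UNIV] by (simp add: continuous_on_eq_continuous_at)
  have top: "(((\<lambda>t. arctan (t / y) / pi) \<circ> real_of_ereal) \<longlongrightarrow> 1/2) (at_left \<infinity>)"
  proof -
    have lim: "filterlim (\<lambda>t. t / y) at_top at_top"
      using filterlim_tendsto_pos_mult_at_top[OF tendsto_const[of "1 / y"] _ filterlim_ident] assms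
      by (simp add: filterlim_ident)
    have "((\<lambda>t. arctan (t / y) / pi) \<longlongrightarrow> (pi/2) / pi) at_top"
      by (intro tendsto_intros filterlim_compose[OF tendsto_arctan_at_top lim]) simp
    then show ?thesis by (simp add: ereal_tendsto_simps comp_assoc)
  qed
  have bot: "(((\<lambda>t. arctan (t / y) / pi) \<circ> real_of_ereal) \<longlongrightarrow> -1/2) (at_right (-\<infinity>))"
  proof -
    have lim: "filterlim (\<lambda>t. t / y) at_bot at_bot"
      using filterlim_tendsto_pos_mult_at_bot[OF tendsto_const[of "1 / y"] _ filterlim_ident] assms
      by (simp add: filterlim_ident)
    have "((\<lambda>t. arctan (t / y) / pi) \<longlongrightarrow> (-(pi/2)) / pi) at_bot"
      by (intro tendsto_intros filterlim_compose[OF tendsto_arctan_at_bot lim]) simp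
    then show ?thesis by (simp add: ereal_tendsto_simps comp_assoc)
  qed
  note * = interval_integral_FTC_nonneg[of "-\<infinity>" "\<infinity>", OF _ deriv cont _ bot top]
  have "set_integrable lborel (einterval (-\<infinity>) \<infinity>) (poisson y)"
    by (rule *(1)) (auto simp: poisson_nonneg assms)
  moreover have "(LBINT x=-\<infinity>..\<infinity>. poisson y x) = 1/2 - (-1/2)"
    by (rule *(2)) (auto simp: poisson_nonneg assms)
  ultimately show ?thesis
    by (simp add: has_bochner_integral_iff set_integrable_def interval_lebesgue_integral_def
        set_lebesgue_integral_def)
qed

text \<open>The path from \<open>n\<close> to \<open>- n\<close> is moved to the other three sides of the rectangle of height \<open>n\<close>.\<close>

lemma primitive_diff_tendsto_0:
  fixes Q q :: "complex \<Rightarrow> complex"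
  assumes deriv: "\<And>s. Im s \<ge> 0 \<Longrightarrow> (Q has_field_derivative q s) (at s)"
    and bound: "\<And>s. Im s \<ge> 0 \<Longrightarrow> cmod s \<ge> R\<^sub>0 \<Longrightarrow> cmod (q s) \<le> B / (cmod s)\<^sup>2"
    and "B \<ge> 0"
  shows "(\<lambda>n. Q (of_real (real n)) - Q (of_real (- real n))) \<longlonglongrightarrow> 0"
proof (rule Lim_null_comparison)
  show "(\<lambda>n. 4 * B / real n) \<longlonglongrightarrow> 0"
    using tendsto_mult_right_zero[OF lim_inverse_n, of "4 * B"] by (simp add: field_simps)
  show "\<forall>\<^sub>F n in sequentially.
    norm (Q (of_real (real n)) - Q (of_real (- real n))) \<le> 4 * B / real n"
  proof (rule eventually_sequentiallyI)
    fix n assume n: "n \<ge> max 1 (nat \<lceil>R\<^sub>0\<rceil>)"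
    define R where "R = real n"
    have R: "R \<ge> R\<^sub>0" "R \<ge> 1" using n unfolding R_def by linarith+
    \<comment> \<open>On each side of the rectangle \<open>cmod s\<close> is at least R, so Q
      changes by at most \<open>B / R\<^sup>2\<close> per unit of length; the three sides have total
      length 4 R, whence the bound 4 B / R.\<close>
    have step: "cmod (Q b - Q a) \<le> B / R\<^sup>2 * cmod (b - a)"
      if seg: "\<And>s. s \<in> closed_segment b a \<Longrightarrow> Im s \<ge> 0 \<and> R \<le> cmod s" for a b
    proof (rule field_differentiable_bound[where S = "closed_segment b a" and f' = q])
      show "(Q has_field_derivative q s) (at s within closed_segment b a)"
        if "s \<in> closed_segment b a" for s
        using deriv that seg
        by (meson has_field_derivative_at_within)
      show "cmod (q s) \<le> B / R\<^sup>2" if "s \<in> closed_segment b a" for s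
      proof -
        have s: "Im s \<ge> 0" "R \<le> cmod s"
          using that seg by auto
        then have "cmod (q s) \<le> B / (cmod s)\<^sup>2" using bound R by auto
        also have "\<dots> \<le> B / R\<^sup>2"
          using s R \<open>B \<ge> 0\<close> by (intro divide_left_mono power_mono mult_pos_pos zero_less_power) auto
        finally show ?thesis .
      qed
    qed auto
    have seg1: "Im s \<ge> 0 \<and> R \<le> cmod s"
      if s: "s \<in> closed_segment (of_real R) (Complex R R)" for s
    proof -
      from s obtain u where u: "0 \<le> u" "u \<le> 1" "s = (1 - u) *\<^sub>R of_real R + u *\<^sub>R Complex R R"
        by (auto simp: in_segment)
      have "Re s = R" "Im s = u * R" unfolding u(3) by (simp_all add: algebra_simps)
      then show ?thesis using u R complex_Re_le_cmod[of s] by auto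
    qed
    have seg2: "Im s \<ge> 0 \<and> R \<le> cmod s"
      if s: "s \<in> closed_segment (Complex R R) (Complex (-R) R)" for s
    proof -
      from s obtain u where u: "s = (1 - u) *\<^sub>R Complex R R + u *\<^sub>R Complex (-R) R"
        by (auto simp: in_segment)
      have "Im s = R" unfolding u by (simp add: algebra_simps)
      then show ?thesis using R abs_Im_le_cmod[of s] by auto
    qed
    have seg3: "Im s \<ge> 0 \<and> R \<le> cmod s"
      if s: "s \<in> closed_segment (Complex (-R) R) (of_real (-R))" for s
    proof -
      from s obtain u where u: "0 \<le> u" "u \<le> 1"
        "s = (1 - u) *\<^sub>R Complex (-R) R + u *\<^sub>R of_real (-R)"
        by (auto simp: in_segment)
      have "Re s = -R" "Im s = (1 - u) * R" unfolding u(3) by (simp_all add: algebra_simps)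
      then show ?thesis using u R abs_Re_le_cmod[of s] by auto
    qed
    have d: "cmod (of_real R - Complex R R) = R" "cmod (Complex R R - Complex (-R) R) = 2 * R"
      "cmod (Complex (-R) R - of_real (-R)) = R"
      using R by (simp_all add: cmod_def complex_of_real_def real_sqrt_mult)
    have "cmod (Q (of_real R) - Q (of_real (-R))) \<le>
      cmod (Q (of_real R) - Q (Complex R R)) + cmod (Q (Complex R R) - Q (Complex (-R) R)) +
      cmod (Q (Complex (-R) R) - Q (of_real (-R)))"
      by norm
    also have "\<dots> \<le> B / R\<^sup>2 * R + B / R\<^sup>2 * (2 * R) + B / R\<^sup>2 * R"
      using step[of "of_real R" "Complex R R", OF seg1]
        step[of "Complex R R" "Complex (-R) R", OF seg2]
        step[of "Complex (-R) R" "of_real (-R)", OF seg3] unfolding d by linarith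
    also have "\<dots> = 4 * B / R" using R by (simp add: field_simps power2_eq_square)
    finally show "cmod (Q (of_real (real n)) - Q (of_real (- real n))) \<le> 4 * B / real n"
      by (simp add: R_def)
  qed
qed

text \<open>Dividing \<open>g s - g (i y)\<close> by \<open>(s - i y) (s + i y)\<close> gives a function without pole in the upper
  half-plane, of size \<open>1 / \<bar>s\<bar>\<^sup>2\<close>, whose integral over the real line therefore vanishes.\<close>

lemma poisson_integral_origin:
  fixes g :: "complex \<Rightarrow> complex"
  assumes "\<delta> > 0" and hol: "g holomorphic_on {s. Im s > - \<delta>}"
    and bound: "\<And>s. Im s \<ge> 0 \<Longrightarrow> cmod (g s) \<le> C" and "y > 0"
  shows "has_bochner_integral lborel (\<lambda>t. of_real (poisson y t) * g (of_real t)) (g (Complex 0 y))"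
proof -
  define \<beta> where "\<beta> = Complex 0 y"
  \<comment> \<open>A half-plane containing the closed upper one, small enough for g to be
    holomorphic on it and for the pole at \<open>- \<beta>\<close> to stay outside.\<close>
  define S where "S = {s. Im s > - min \<delta> y}"
  have S: "open S" "convex S"
    unfolding S_def by (auto simp: open_halfspace_Im_gt convex_halfspace_Im_gt)
  define D where "D s = (if s = \<beta> then deriv g \<beta> else (g s - g \<beta>) / (s - \<beta>))" for s
  \<comment> \<open>On the real line the two linear factors multiply to
    \<open>t\<^sup>2 + y\<^sup>2\<close>; the factor \<open>y / pi\<close> then makes q equal to the
    Poisson kernel times \<open>g t - g \<beta>\<close>.\<close>
  define q where "q s = of_real (y / pi) * D s / (s + \<beta>)" for s
  have "D holomorphic_on S"
    unfolding D_def[abs_def]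
    by (rule pole_lemma_open[OF holomorphic_on_subset[OF hol] S(1)]) (auto simp: S_def)
  moreover have "s + \<beta> \<noteq> 0" if "s \<in> S" for s
    using that by (auto simp: S_def \<beta>_def complex_eq_iff)
  ultimately have qhol: "q holomorphic_on S"
    unfolding q_def[abs_def] by (intro holomorphic_intros) auto
  obtain Q where Q: "\<And>s. s \<in> S \<Longrightarrow> (Q has_field_derivative q s) (at s within S)"
    using holomorphic_convex_primitive'[OF S(2,1) qhol] by auto
  have up: "s \<in> S" if "Im s \<ge> 0" for s
    using that assms by (auto simp: S_def)
  have Q': "(Q has_field_derivative q s) (at s)" if "Im s \<ge> 0" for s
    using Q[OF up[OF that]] unfolding at_within_open[OF up[OF that] S(1)] .
  have C: "C \<ge> 0" by (rule order_trans[OF norm_ge_zero bound[of 0]]) simp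
  \<comment> \<open>Beyond radius 2 y, twice the modulus of \<beta>, both linear factors have
    modulus at least half that of s; with 2 C for the numerator this gives the constant 8 C.\<close>
  have qb: "cmod (q s) \<le> (8 * C * y / pi) / (cmod s)\<^sup>2"
    if s: "Im s \<ge> 0" "cmod s \<ge> 2 * y" for s
  proof -
    have cb: "cmod \<beta> = y" using assms by (simp add: \<beta>_def cmod_def)
    have 1: "cmod (s - \<beta>) \<ge> cmod s / 2" using norm_triangle_ineq2[of s \<beta>] s cb by simp
    have 2: "cmod (s + \<beta>) \<ge> cmod s / 2"
      using norm_triangle_ineq2[of s "- \<beta>"] s cb by simp
    have s0: "cmod s > 0" using s assms by linarith
    have ne: "s \<noteq> \<beta>" using cb s(2) \<open>y > 0\<close> by auto
    have "cmod (g s - g \<beta>) \<le> 2 * C"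
      using norm_triangle_ineq4[of "g s" "g \<beta>"] bound[OF s(1)] bound[of \<beta>] \<open>y > 0\<close>
      by (simp add: \<beta>_def)
    then have "cmod (g s - g \<beta>) / (cmod (s - \<beta>) * cmod (s + \<beta>)) \<le> 2 * C / (cmod s / 2 * (cmod s / 2))"
      using 1 2 s0 C by (intro frac_le mult_mono) auto
    also have "\<dots> = 8 * C / (cmod s)\<^sup>2" using s0 by (simp add: field_simps power2_eq_square)
    finally have "(y / pi) * (cmod (g s - g \<beta>) / (cmod (s - \<beta>) * cmod (s + \<beta>))) \<le> (y / pi) * (8 * C / (cmod s)\<^sup>2)"
      using assms by (intro mult_left_mono) auto
    moreover have "cmod (q s) = (y / pi) * (cmod (g s - g \<beta>) / (cmod (s - \<beta>) * cmod (s + \<beta>)))"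
      using ne assms by (simp add: q_def D_def norm_divide norm_mult)
    ultimately show ?thesis by (simp add: mult_ac)
  qed
  have qreal: "q (of_real t) = of_real (poisson y t) * (g (of_real t) - g \<beta>)" for t
  proof -
    have ne: "complex_of_real t \<noteq> \<beta>" "complex_of_real t + \<beta> \<noteq> 0"
      using assms by (auto simp: \<beta>_def complex_eq_iff)
    have "(complex_of_real t - \<beta>) * (of_real t + \<beta>) = of_real (t\<^sup>2 + y\<^sup>2)"
      by (simp add: \<beta>_def complex_eq_iff power2_eq_square)
    moreover have "q (of_real t) =
        of_real (y / pi) * (g (of_real t) - g \<beta>) / ((of_real t - \<beta>) * (of_real t + \<beta>))"
      using ne by (simp add: q_def D_def)
    ultimately show ?thesis by (simp add: poisson_def)
  qed
  note P = has_bochner_integral_poisson[OF \<open>y > 0\<close>]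
  have contg: "continuous_on UNIV (\<lambda>t::real. g (of_real t))"
    using \<open>\<delta> > 0\<close> by (intro continuous_on_compose2[OF holomorphic_on_imp_continuous_on[OF hol]]
        continuous_intros) auto
  have gm [measurable]: "(\<lambda>t::real. g (of_real t)) \<in> borel_measurable borel"
    by (rule borel_measurable_continuous_onI[OF contg])
  have qcont: "continuous_on UNIV (\<lambda>t::real. q (of_real t))"
    unfolding qreal using contg continuous_on_poisson[OF \<open>y > 0\<close>] by (intro continuous_intros) auto
  have bnd: "cmod (of_real (poisson y t) * (g (of_real t) - g \<beta>)) \<le> 2 * C * poisson y t" for t
  proof -
    have "cmod (g (of_real t) - g \<beta>) \<le> 2 * C"
      using norm_triangle_ineq4[of "g (of_real t)" "g \<beta>"] bound[of "of_real t"] bound[of \<beta>] \<open>y > 0\<close>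
      by (simp add: \<beta>_def)
    then show ?thesis
      using mult_left_mono[of "cmod (g (of_real t) - g \<beta>)" "2 * C" "poisson y t"]
        poisson_nonneg[OF \<open>y > 0\<close>, of t]
      by (simp add: norm_mult mult_ac)
  qed
  have int: "integrable lborel (\<lambda>t. q (of_real t))"
    unfolding qreal
  proof (rule Bochner_Integration.integrable_bound)
    show "integrable lborel (\<lambda>t. 2 * C * poisson y t)"
      using P by (simp add: has_bochner_integral_iff)
    show "AE t in lborel. norm (of_real (poisson y t) * (g (of_real t) - g \<beta>)) \<le> norm (2 * C * poisson y t)"
      by (intro AE_I2 order_trans[OF bnd]) simp
  qed measurable
  \<comment> \<open>The primitive computes integrals over bounded intervals; integrability of q lets
    these converge to the integral over the line.\<close>
  have "(\<lambda>n. LINT t|lborel. indicator {- real n..real n} t *\<^sub>R q (of_real t)) \<longlonglongrightarrow> (LINT t|lborel. q (of_real t))"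
  proof (rule integral_dominated_convergence[where w = "\<lambda>t. norm (q (of_real t))"])
    show "AE t in lborel. (\<lambda>n. indicator {- real n..real n} t *\<^sub>R q (of_real t)) \<longlonglongrightarrow> q (of_real t)"
    proof (intro AE_I2 tendsto_eventually)
      fix t :: real
      show "\<forall>\<^sub>F n in sequentially. indicator {- real n..real n} t *\<^sub>R q (of_real t) = q (of_real t)"
      proof (rule eventually_sequentiallyI)
        fix n assume "nat \<lceil>\<bar>t\<bar>\<rceil> \<le> n"
        then have "\<bar>t\<bar> \<le> real n" by linarith
        then have "t \<in> {- real n..real n}" by auto
        then show "indicator {- real n..real n} t *\<^sub>R q (of_real t) = q (of_real t)" by simp
      qed
    qed
  qed (use int in \<open>auto simp: indicator_def\<close>)
  moreover have "(LINT t|lborel. indicator {- real n..real n} t *\<^sub>R q (of_real t)) =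
      Q (of_real (real n)) - Q (of_real (- real n))" for n
  proof (rule integral_FTC_Icc)
    show "((\<lambda>x. Q (of_real x)) has_vector_derivative q (of_real x)) (at x within {- real n..real n})" for x
      by (rule has_vector_derivative_at_within)
        (use field_vector_diff_chain_at[OF has_vector_derivative_of_real[OF DERIV_ident] Q'[of "of_real x"]]
          in \<open>simp add: o_def\<close>)
  qed (use qcont in \<open>auto intro: continuous_on_subset\<close>)
  moreover have "(\<lambda>n. Q (of_real (real n)) - Q (of_real (- real n))) \<longlonglongrightarrow> 0"
    by (rule primitive_diff_tendsto_0[OF Q' qb]) (use C assms in auto)
  ultimately have "(LINT t|lborel. q (of_real t)) = 0"
    using LIMSEQ_unique by fastforce
  then have "has_bochner_integral lborel (\<lambda>t. q (of_real t)) 0"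
    using int by (simp add: has_bochner_integral_iff)
  \<comment> \<open>The subtracted constant is put back: against a density of total mass 1 it
    integrates to \<open>g \<beta>\<close>.\<close>
  from has_bochner_integral_add[OF this
      has_bochner_integral_mult_left[OF has_bochner_integral_of_real[OF P], of "g \<beta>"]]
  show ?thesis by (simp add: qreal \<beta>_def algebra_simps)
qed

text \<open>\<open>poisson y\<close> is a probability density under which the boundary values have
  mean \<open>g (Complex x y)\<close>. Their variance is nonnegative and equals the mean square
  minus the squared modulus of the mean.\<close>

lemma poisson_norm_sq_le:
  fixes g :: "complex \<Rightarrow> complex"
  assumes "\<delta> > 0" and hol: "g holomorphic_on {s. Im s > - \<delta>}"
    and bound: "\<And>s. Im s \<ge> 0 \<Longrightarrow> cmod (g s) \<le> C" and "y > 0"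
  shows "ennreal ((cmod (g (Complex x y)))\<^sup>2) \<le>
     (\<integral>\<^sup>+t. ennreal (poisson y t) * ennreal ((cmod (g (of_real (x + t))))\<^sup>2) \<partial>lborel)"
proof -
  define h where "h s = g (of_real x + s)" for s
  have hh: "h holomorphic_on {s. Im s > - \<delta>}"
    unfolding h_def[abs_def]
    by (rule holomorphic_on_compose_gen[OF _ hol, unfolded o_def]) (auto intro!: holomorphic_intros)
  have hb: "cmod (h s) \<le> C" if "Im s \<ge> 0" for s using bound that by (simp add: h_def)
  define c where "c = h (Complex 0 y)"
  have "of_real x + Complex 0 y = Complex x y" by (simp add: complex_eq_iff)
  then have ch: "c = g (Complex x y)" by (simp add: c_def h_def)
  note P = has_bochner_integral_poisson[OF \<open>y > 0\<close>]
  note I = poisson_integral_origin[OF \<open>\<delta> > 0\<close> hh hb \<open>y > 0\<close>, folded c_def]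
  have contg: "continuous_on UNIV (\<lambda>t::real. h (of_real t))"
    using \<open>\<delta> > 0\<close> by (intro continuous_on_compose2[OF holomorphic_on_imp_continuous_on[OF hh]]
        continuous_intros) auto
  have gm [measurable]: "(\<lambda>t::real. h (of_real t)) \<in> borel_measurable borel"
    by (rule borel_measurable_continuous_onI[OF contg])
  have C2: "poisson y t * (cmod (h (of_real t)))\<^sup>2 \<le> C\<^sup>2 * poisson y t" for t
    using mult_left_mono[OF power_mono[OF hb[of "of_real t"] norm_ge_zero], of "poisson y t" 2]
      poisson_nonneg[OF \<open>y > 0\<close>] by (simp add: mult_ac)
  have int2: "integrable lborel (\<lambda>t. poisson y t * (cmod (h (of_real t)))\<^sup>2)"
  proof (rule Bochner_Integration.integrable_bound)
    show "integrable lborel (\<lambda>t. C\<^sup>2 * poisson y t)"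
      using P by (simp add: has_bochner_integral_iff)
    show "AE t in lborel. norm (poisson y t * (cmod (h (of_real t)))\<^sup>2) \<le> norm (C\<^sup>2 * poisson y t)"
      using C2 poisson_nonneg[OF \<open>y > 0\<close>] by (intro AE_I2) (simp add: abs_mult)
  qed measurable
  \<comment> \<open>Since c is the mean of h, the cross term of the expanded square integrates to
    twice the squared modulus of c.\<close>
  have cross: "has_bochner_integral lborel (\<lambda>t. poisson y t * (2 * Re (h (of_real t) * cnj c))) (2 * (cmod c)\<^sup>2)"
  proof -
    from has_bochner_integral_Re[OF has_bochner_integral_mult_left[OF I, of "2 * cnj c"]]
    have "has_bochner_integral lborel (\<lambda>t. Re (of_real (poisson y t) * h (of_real t) * (2 * cnj c))) (Re (c * (2 * cnj c)))"
      by simp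
    moreover have "Re (of_real p * w * (2 * cnj c)) = p * (2 * Re (w * cnj c))" for p w
      by (simp add: algebra_simps)
    moreover have "Re (c * (2 * cnj c)) = 2 * (cmod c)\<^sup>2"
      unfolding cmod_power2 by (simp add: power2_eq_square)
    ultimately show ?thesis by simp
  qed
  have sq: "(cmod (w - c))\<^sup>2 = (cmod w)\<^sup>2 - 2 * Re (w * cnj c) + (cmod c)\<^sup>2" for w
    unfolding cmod_power2 by (simp add: power2_eq_square algebra_simps)
  have "0 \<le> (LINT t|lborel. poisson y t * (cmod (h (of_real t) - c))\<^sup>2)"
    by (intro integral_nonneg_AE AE_I2) (simp add: poisson_nonneg \<open>y > 0\<close>)
  also have "\<dots> = (LINT t|lborel. poisson y t * (cmod (h (of_real t)))\<^sup>2 -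
      poisson y t * (2 * Re (h (of_real t) * cnj c)) + poisson y t * (cmod c)\<^sup>2)"
    by (intro Bochner_Integration.integral_cong) (auto simp: sq algebra_simps)
  also have "\<dots> = (LINT t|lborel. poisson y t * (cmod (h (of_real t)))\<^sup>2) - 2 * (cmod c)\<^sup>2 + (cmod c)\<^sup>2"
    using int2 P cross by (simp add: has_bochner_integral_iff)
  finally have "(cmod c)\<^sup>2 \<le> (LINT t|lborel. poisson y t * (cmod (h (of_real t)))\<^sup>2)" by simp
  then have "ennreal ((cmod c)\<^sup>2) \<le> ennreal (LINT t|lborel. poisson y t * (cmod (h (of_real t)))\<^sup>2)"
    by (rule ennreal_leI)
  also have "\<dots> = (\<integral>\<^sup>+t. ennreal (poisson y t * (cmod (h (of_real t)))\<^sup>2) \<partial>lborel)"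
    by (rule nn_integral_eq_integral[symmetric, OF int2]) (simp add: poisson_nonneg \<open>y > 0\<close>)
  finally show ?thesis
    by (simp add: ch h_def ennreal_mult poisson_nonneg \<open>y > 0\<close>)
qed

section \<open>Functions decaying on a neighbourhood of the closed tube\<close>

text \<open>For positive \<delta> this is an open neighbourhood of the closed tube, in particular of
  its real boundary.\<close>

definition half_space :: "real \<Rightarrow> (complex ^ 'n) set" where
  "half_space \<delta> = {w. \<forall>k. Im (w $ k) > - \<delta>}"

definition set_coord :: "complex ^ 'n \<Rightarrow> 'n \<Rightarrow> complex \<Rightarrow> complex ^ 'n" where
  "set_coord w k s = (\<chi> j. if j = k then s else w $ j)"

text \<open>The rate provided by one simple pole in every variable: square integrable, though not
  integrable.\<close>

definition decay :: "real ^ 'n::finite \<Rightarrow> real" where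
  "decay x = (\<Prod>k\<in>UNIV. 1 / (1 + \<bar>x $ k\<bar>))"

text \<open>Holomorphy is asked in one variable at a time, the form in which the Poisson formula
  takes it; joint continuity makes slices measurable and carries them to the boundary. The majorant
  does not depend on the imaginary part, so it can dominate all slices at once.\<close>

definition decaying_on :: "real \<Rightarrow> real \<Rightarrow> (complex ^ 'n::finite \<Rightarrow> complex) \<Rightarrow> bool" where
  "decaying_on \<delta> C G \<longleftrightarrow> continuous_on (half_space \<delta>) G \<and>
     (\<forall>w\<in>half_space \<delta>. \<forall>k. (\<lambda>s. G (set_coord w k s)) holomorphic_on {s. Im s > - \<delta>}) \<and>
     (\<forall>w\<in>half_space \<delta>. cmod (G w) \<le> C * decay (\<chi> k. Re (w $ k)))"

definition decaying :: "(complex ^ 'n::finite \<Rightarrow> complex) \<Rightarrow> bool" where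
  "decaying G \<longleftrightarrow> (\<exists>\<delta>>0. \<exists>C. decaying_on \<delta> C G)"

lemma decay_pos: "decay x > 0"
  unfolding decay_def by (intro prod_pos) (simp add: add_pos_nonneg)

lemma decay_le_1: "decay x \<le> 1"
  unfolding decay_def by (intro prod_le_1) (auto simp: divide_simps)

lemma borel_measurable_decay [measurable]: "decay \<in> borel_measurable borel"
  unfolding decay_def[abs_def] by measurable

lemma prod_Basis_vec:
  fixes x :: "real ^ 'n"
  shows "(\<Prod>b\<in>Basis. f (x \<bullet> b)) = (\<Prod>k\<in>UNIV. f (x $ k))"
proof (rule prod.reindex_cong)
  show "inj (\<lambda>k::'n. axis k (1::real))" by (auto simp: inj_on_def axis_eq_axis)
  show "(Basis :: (real ^ 'n) set) = range (\<lambda>k. axis k 1)" by (auto simp: Basis_vec_def)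
qed (simp add: inner_axis)

text \<open>The integral factors over the coordinates. In one variable the square of
  \<open>1 + \<bar>t\<bar>\<close> is at least \<open>t\<^sup>2 + 1\<close>, so the integrand is at
  most \<open>pi * poisson 1 t\<close>.\<close>

lemma nn_integral_decay_sq: "(\<integral>\<^sup>+x. ennreal ((decay (x :: real ^ 'n))\<^sup>2) \<partial>lborel) < \<infinity>"
proof -
  have 1: "(\<integral>\<^sup>+t. ennreal ((1 / (1 + \<bar>t\<bar>))\<^sup>2) \<partial>lborel) < \<infinity>"
  proof -
    have "(1 / (1 + \<bar>t\<bar>))\<^sup>2 \<le> pi * poisson 1 t" for t :: real
    proof -
      have "(1 / (1 + \<bar>t\<bar>))\<^sup>2 = 1 / (1 + \<bar>t\<bar>)\<^sup>2" by (simp add: power_one_over)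
      also have "\<dots> \<le> 1 / (t\<^sup>2 + 1)"
        by (intro divide_left_mono mult_pos_pos)
          (auto simp: power2_sum add_pos_nonneg intro!: add_nonneg_pos)
      finally show ?thesis by (simp add: poisson_def)
    qed
    then have "(\<integral>\<^sup>+t. ennreal ((1 / (1 + \<bar>t\<bar>))\<^sup>2) \<partial>lborel) \<le> (\<integral>\<^sup>+t. ennreal (pi * poisson 1 t) \<partial>lborel)"
      by (intro nn_integral_mono ennreal_leI)
    also have "\<dots> = ennreal (LINT t|lborel. pi * poisson 1 t)"
      using has_bochner_integral_poisson[of 1]
      by (intro nn_integral_eq_integral) (auto simp: has_bochner_integral_iff poisson_nonneg)
    finally show ?thesis by (simp add: top.not_eq_extremum less_le_trans order_le_less_trans)
  qed
  have "(\<integral>\<^sup>+x. ennreal ((decay (x :: real ^ 'n))\<^sup>2) \<partial>lborel) =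
      (\<integral>\<^sup>+x. (\<Prod>b\<in>(Basis :: (real ^ 'n) set). ennreal ((1 / (1 + \<bar>x \<bullet> b\<bar>))\<^sup>2)) \<partial>lborel)"
    unfolding decay_def prod_Basis_vec[of "\<lambda>t. ennreal ((1 / (1 + \<bar>t\<bar>))\<^sup>2)"]
    by (simp add: prod_power_distrib prod_ennreal flip: prod_power_distrib)
  also have "\<dots> = (\<Prod>b\<in>(Basis :: (real ^ 'n) set). \<integral>\<^sup>+t. ennreal ((1 / (1 + \<bar>t\<bar>))\<^sup>2) \<partial>lborel)"
    by (intro nn_integral_lborel_prod) auto
  also have "\<dots> < \<infinity>"
    using 1 by (simp add: power_less_top_ennreal)
  finally show ?thesis .
qed

lemma half_space_mono: "\<delta> \<le> \<delta>' \<Longrightarrow> (half_space \<delta> :: (complex ^ 'n) set) \<subseteq> half_space \<delta>'"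
proof
  fix w :: "complex ^ 'n" assume le: "\<delta> \<le> \<delta>'" and w: "w \<in> half_space \<delta>"
  have "Im (w $ k) > - \<delta>'" for k
    using w le unfolding half_space_def by (simp add: order_le_less_trans[of "- \<delta>'" "- \<delta>"])
  then show "w \<in> half_space \<delta>'" by (simp add: half_space_def)
qed

lemma decaying_on_mono:
  fixes G :: "complex ^ 'n \<Rightarrow> complex"
  assumes "decaying_on \<delta> C G" "\<delta>' \<le> \<delta>"
  shows "decaying_on \<delta>' C G"
proof -
  have "half_space \<delta>' \<subseteq> (half_space \<delta> :: (complex ^ 'n) set)" "{s. Im s > - \<delta>'} \<subseteq> {s. Im s > - \<delta>}"
    using half_space_mono[OF assms(2)] assms(2) by auto
  then show ?thesis
    using assms(1) unfolding decaying_on_def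
    by (meson continuous_on_subset holomorphic_on_subset subsetD)
qed

lemma decaying_add:
  fixes f g :: "complex ^ 'n \<Rightarrow> complex"
  assumes "decaying f" "decaying g"
  shows "decaying (\<lambda>w. f w + g w)"
proof -
  obtain \<delta>1 C1 \<delta>2 C2 where *: "\<delta>1 > 0" "decaying_on \<delta>1 C1 f" "\<delta>2 > 0" "decaying_on \<delta>2 C2 g"
    using assms unfolding decaying_def by blast
  define \<delta> where "\<delta> = min \<delta>1 \<delta>2"
  have d: "decaying_on \<delta> C1 f" "decaying_on \<delta> C2 g" "\<delta> > 0"
    using * by (auto simp: \<delta>_def intro: decaying_on_mono)
  have "decaying_on \<delta> (C1 + C2) (\<lambda>w. f w + g w)"
    unfolding decaying_on_def
  proof (intro conjI ballI allI)
    show "continuous_on (half_space \<delta>) (\<lambda>w. f w + g w)"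
      using d unfolding decaying_on_def by (intro continuous_on_add) auto
    fix w :: "complex ^ 'n" assume w: "w \<in> half_space \<delta>"
    show "(\<lambda>s. f (set_coord w k s) + g (set_coord w k s)) holomorphic_on {s. Im s > - \<delta>}" for k
      using d w unfolding decaying_on_def by (intro holomorphic_on_add) auto
    have "cmod (f w) \<le> C1 * decay (\<chi> k. Re (w $ k))" "cmod (g w) \<le> C2 * decay (\<chi> k. Re (w $ k))"
      using d w unfolding decaying_on_def by auto
    then show "cmod (f w + g w) \<le> (C1 + C2) * decay (\<chi> k. Re (w $ k))"
      using norm_triangle_ineq[of "f w" "g w"] by (simp add: distrib_right)
  qed
  then show ?thesis using d unfolding decaying_def by blast
qed

lemma decaying_cmult:
  fixes f :: "complex ^ 'n \<Rightarrow> complex"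
  assumes "decaying f"
  shows "decaying (\<lambda>w. c * f w)"
proof -
  obtain \<delta> C where d: "\<delta> > 0" "decaying_on \<delta> C f"
    using assms unfolding decaying_def by blast
  have "decaying_on \<delta> (cmod c * C) (\<lambda>w. c * f w)"
    unfolding decaying_on_def
  proof (intro conjI ballI allI)
    show "continuous_on (half_space \<delta>) (\<lambda>w. c * f w)"
      using d unfolding decaying_on_def by (intro continuous_on_mult_left) auto
    fix w :: "complex ^ 'n" assume w: "w \<in> half_space \<delta>"
    show "(\<lambda>s. c * f (set_coord w k s)) holomorphic_on {s. Im s > - \<delta>}" for k
      using d w unfolding decaying_on_def by (intro holomorphic_on_mult holomorphic_on_const) auto
    have "cmod (f w) \<le> C * decay (\<chi> k. Re (w $ k))"
      using d w unfolding decaying_on_def by auto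
    then show "cmod (c * f w) \<le> (cmod c * C) * decay (\<chi> k. Re (w $ k))"
      by (simp add: norm_mult mult.assoc mult_left_mono)
  qed
  then show ?thesis using d unfolding decaying_def by blast
qed

lemma continuous_on_cpoint [continuous_intros]:
  assumes "continuous_on A f" "continuous_on A g"
  shows "continuous_on A (\<lambda>x. cpoint (f x) (g x))"
proof -
  have "continuous_on A (\<lambda>x. complex_of_real (f x $ k) + \<i> * complex_of_real (g x $ k))" for k
    by (intro continuous_intros assms)
  then have "continuous_on A (\<lambda>x. \<chi> k. complex_of_real (f x $ k) + \<i> * complex_of_real (g x $ k))"
    by (rule continuous_on_vec_lambda)
  moreover have "(\<chi> k. complex_of_real (f x $ k) + \<i> * complex_of_real (g x $ k)) = cpoint (f x) (g x)" for x
    by (simp add: cpoint_def vec_eq_iff complex_eq_iff)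
  ultimately show ?thesis by simp
qed

lemma cpoint_in_half_space:
  assumes "\<delta> > 0" "\<And>k. y $ k \<ge> 0"
  shows "cpoint x y \<in> half_space \<delta>"
  unfolding half_space_def cpoint_def
proof clarsimp
  show "- \<delta> < y $ k" for k using assms(1) assms(2)[of k] by linarith
qed

lemma decaying_on_measurable:
  assumes "decaying_on \<delta> C G" "\<delta> > 0" "\<And>k. y $ k \<ge> 0"
  shows "(\<lambda>x. G (cpoint x y)) \<in> borel_measurable borel"
proof (rule borel_measurable_continuous_onI)
  show "continuous_on UNIV (\<lambda>x. G (cpoint x y))"
  proof (rule continuous_on_compose2[of "half_space \<delta>" G])
    show "continuous_on (half_space \<delta>) G" using assms(1) by (simp add: decaying_on_def)
    show "continuous_on UNIV (\<lambda>x. cpoint x y)" by (intro continuous_intros)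
    show "(\<lambda>x. cpoint x y) ` UNIV \<subseteq> half_space \<delta>"
      using cpoint_in_half_space[OF assms(2,3)] by blast
  qed
qed

lemma decaying_on_cpoint_bound:
  assumes "decaying_on \<delta> C G" "\<delta> > 0" "\<And>k. y $ k \<ge> 0"
  shows "cmod (G (cpoint x y)) \<le> C * decay x"
proof -
  have "cpoint x y \<in> half_space \<delta>"
    by (rule cpoint_in_half_space[OF assms(2,3)])
  then have "cmod (G (cpoint x y)) \<le> C * decay (\<chi> k. Re (cpoint x y $ k))"
    using assms by (auto simp: decaying_on_def)
  then show ?thesis by (simp add: cpoint_def)
qed

text \<open>Translation invariance of Lebesgue measure avoids any splitting into coordinates.\<close>

lemma decaying_contraction_coord:
  fixes G :: "complex ^ 'n \<Rightarrow> complex"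
  assumes G: "decaying_on \<delta> C G" "\<delta> > 0" and y: "\<And>j. y $ j \<ge> 0" and yk: "y $ k = 0" and "s > 0"
  shows "(\<integral>\<^sup>+x. ennreal ((cmod (G (cpoint x (y + s *\<^sub>R axis k 1))))\<^sup>2) \<partial>lborel)
    \<le> (\<integral>\<^sup>+x. ennreal ((cmod (G (cpoint x y)))\<^sup>2) \<partial>lborel)"
proof -
  let ?e = "axis k 1 :: real ^ 'n"
  define f where "f x = ennreal ((cmod (G (cpoint x y)))\<^sup>2)" for x
  have fm [measurable]: "f \<in> borel_measurable borel"
    using decaying_on_measurable[OF G, of y] y unfolding f_def[abs_def] by measurable
  have inH: "cpoint x y \<in> half_space \<delta>" for x
    by (rule cpoint_in_half_space[OF G(2) y])
  have C: "C \<ge> 0"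
    using decaying_on_cpoint_bound[OF G y, of 0] decay_pos[of "0::real^'n"]
    by (smt (verit) norm_ge_zero zero_le_mult_iff)
  have le: "ennreal ((cmod (G (cpoint x (y + s *\<^sub>R ?e))))\<^sup>2)
    \<le> (\<integral>\<^sup>+t. ennreal (poisson s t) * f (x + t *\<^sub>R ?e) \<partial>lborel)" for x
  proof -
    define g where "g \<zeta> = G (set_coord (cpoint x y) k \<zeta>)" for \<zeta>
    have hol: "g holomorphic_on {\<zeta>. Im \<zeta> > - \<delta>}"
      using G(1) inH unfolding g_def[abs_def] decaying_on_def by blast
    have bound: "cmod (g \<zeta>) \<le> C" if "Im \<zeta> \<ge> 0" for \<zeta>
    proof -
      have "set_coord (cpoint x y) k \<zeta> \<in> half_space \<delta>"
        using inH[of x] that \<open>\<delta> > 0\<close> by (auto simp: half_space_def set_coord_def)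
      then have "cmod (g \<zeta>) \<le> C * decay (\<chi> j. Re (set_coord (cpoint x y) k \<zeta> $ j))"
        using G(1) unfolding g_def decaying_on_def by blast
      also have "\<dots> \<le> C" by (rule mult_left_le[OF decay_le_1 C])
      finally show ?thesis .
    qed
    \<comment> \<open>As \<open>y $ k = 0\<close>, coordinate k of \<open>cpoint x y\<close> is
      real: sliding it along the real line translates x, lifting it to height s raises y in
      direction k.\<close>
    have 1: "set_coord (cpoint x y) k (Complex (x $ k) s) = cpoint x (y + s *\<^sub>R ?e)"
      using yk by (auto simp: set_coord_def cpoint_def vec_eq_iff axis_def complex_eq_iff)
    have 2: "set_coord (cpoint x y) k (of_real (x $ k + t)) = cpoint (x + t *\<^sub>R ?e) y" for t
      using yk by (auto simp: set_coord_def cpoint_def vec_eq_iff axis_def complex_eq_iff)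
    from poisson_norm_sq_le[OF \<open>\<delta> > 0\<close> hol bound \<open>s > 0\<close>, of "x $ k"]
    show ?thesis unfolding g_def 1 2 f_def .
  qed
  have "(\<integral>\<^sup>+x. ennreal ((cmod (G (cpoint x (y + s *\<^sub>R ?e))))\<^sup>2) \<partial>lborel)
    \<le> (\<integral>\<^sup>+x. \<integral>\<^sup>+t. ennreal (poisson s t) * f (x + t *\<^sub>R ?e) \<partial>lborel \<partial>lborel)"
    by (intro nn_integral_mono le)
  also have "\<dots> = (\<integral>\<^sup>+t. \<integral>\<^sup>+x. ennreal (poisson s t) * f (x + t *\<^sub>R ?e) \<partial>lborel \<partial>lborel)"
    by (rule lborel_pair.Fubini'[symmetric]) measurable
  also have "\<dots> = (\<integral>\<^sup>+t. ennreal (poisson s t) * (\<integral>\<^sup>+x. f x \<partial>lborel) \<partial>lborel)"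
  proof (intro nn_integral_cong)
    fix t :: real
    have "(\<integral>\<^sup>+x. f x \<partial>lborel) = (\<integral>\<^sup>+x. f x \<partial>distr lborel borel ((+) (t *\<^sub>R ?e)))"
      by (simp add: lborel_distr_plus)
    also have "\<dots> = (\<integral>\<^sup>+x. f (x + t *\<^sub>R ?e) \<partial>lborel)"
      by (simp add: nn_integral_distr add.commute)
    finally show "(\<integral>\<^sup>+x. ennreal (poisson s t) * f (x + t *\<^sub>R ?e) \<partial>lborel) =
        ennreal (poisson s t) * (\<integral>\<^sup>+x. f x \<partial>lborel)"
      by (simp add: nn_integral_cmult)
  qed
  also have "\<dots> = (\<integral>\<^sup>+t. ennreal (poisson s t) \<partial>lborel) * (\<integral>\<^sup>+x. f x \<partial>lborel)"
    by (simp add: nn_integral_multc)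
  also have "(\<integral>\<^sup>+t. ennreal (poisson s t) \<partial>lborel) = 1"
    using has_bochner_integral_poisson[OF \<open>s > 0\<close>]
    by (subst nn_integral_eq_integral) (auto simp: has_bochner_integral_iff poisson_nonneg \<open>s > 0\<close>)
  finally show ?thesis by (simp add: f_def)
qed

text \<open>The coordinates of the imaginary part are lifted from 0 to their final heights one after
  another. In \<open>v S\<close> those in S are lifted, so the next one is still 0, as
  \<open>decaying_contraction_coord\<close> demands.\<close>

lemma decaying_contraction:
  fixes G :: "complex ^ 'n \<Rightarrow> complex"
  assumes "decaying G" and y: "y \<in> first_octant"
  shows "(\<integral>\<^sup>+x. ennreal ((cmod (G (cpoint x y)))\<^sup>2) \<partial>lborel)
    \<le> (\<integral>\<^sup>+x. ennreal ((cmod (G (cpoint x 0)))\<^sup>2) \<partial>lborel)"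
proof -
  obtain \<delta> C where d: "\<delta> > 0" "decaying_on \<delta> C G"
    using assms unfolding decaying_def by blast
  define v where "v S = (\<chi> j. if j \<in> S then y $ j else 0)" for S
  have yp: "y $ j > 0" for j using y by (simp add: first_octant_def)
  have "(\<integral>\<^sup>+x. ennreal ((cmod (G (cpoint x (v S))))\<^sup>2) \<partial>lborel)
    \<le> (\<integral>\<^sup>+x. ennreal ((cmod (G (cpoint x 0)))\<^sup>2) \<partial>lborel)" for S
    using finite[of S]
  proof (induction S rule: finite_induct)
    case empty
    have "v {} = 0" by (simp add: v_def vec_eq_iff)
    then show ?case by simp
  next
    case (insert k S)
    have eq: "v (insert k S) = v S + y $ k *\<^sub>R axis k 1"
      using insert by (auto simp: v_def vec_eq_iff axis_def)
    have "v S $ j \<ge> 0" for j using yp[of j] by (simp add: v_def)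
    moreover have "v S $ k = 0" using insert by (simp add: v_def)
    ultimately show ?case
      unfolding eq by (rule order_trans[OF decaying_contraction_coord[OF d(2,1) _ _ yp] insert.IH])
  qed
  from this[of UNIV] show ?thesis by (simp add: v_def)
qed

lemma decaying_measurable:
  assumes "decaying G" "\<And>k. y $ k \<ge> 0"
  shows "(\<lambda>x. G (cpoint x y)) \<in> borel_measurable borel"
proof -
  obtain \<delta> C where "\<delta> > 0" "decaying_on \<delta> C G"
    using assms unfolding decaying_def by blast
  then show ?thesis by (rule decaying_on_measurable[rotated, OF _ assms(2)])
qed

lemma first_octant_nonneg: "y \<in> first_octant \<Longrightarrow> 0 \<le> y $ k"
  by (simp add: first_octant_def less_imp_le)

text \<open>Continuity across the boundary gives pointwise convergence of the slices, and twice the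
  majorant \<open>C * decay x\<close> dominates all differences.\<close>

lemma decaying_boundary:
  fixes G :: "complex ^ 'n \<Rightarrow> complex"
  assumes "decaying G"
  shows "is_boundary_limit G (\<lambda>x. G (cpoint x 0))"
proof -
  obtain \<delta> C where d: "\<delta> > 0" "decaying_on \<delta> C G"
    using assms unfolding decaying_def by blast
  note bound = decaying_on_cpoint_bound[OF d(2,1)]
  have m0 [measurable]: "(\<lambda>x. G (cpoint x 0)) \<in> borel_measurable borel"
    using decaying_measurable[OF assms] by simp
  have C: "C \<ge> 0"
    using bound[of 0 0] decay_pos[of "0::real^'n"]
    by (smt (verit) norm_ge_zero zero_le_mult_iff zero_index)
  have fin: "(\<integral>\<^sup>+x. ennreal ((c * decay (x :: real ^ 'n))\<^sup>2) \<partial>lborel) < \<infinity>" for c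
  proof -
    have "(\<integral>\<^sup>+x. ennreal ((c * decay (x :: real ^ 'n))\<^sup>2) \<partial>lborel) =
        ennreal (c\<^sup>2) * (\<integral>\<^sup>+x. ennreal ((decay (x :: real ^ 'n))\<^sup>2) \<partial>lborel)"
      by (simp add: power_mult_distrib ennreal_mult nn_integral_cmult)
    also have "\<dots> < \<infinity>" using nn_integral_decay_sq[where 'n = 'n] by (simp add: ennreal_mult_less_top)
    finally show ?thesis .
  qed
  have "(\<integral>\<^sup>+x. ennreal ((cmod (G (cpoint x 0)))\<^sup>2) \<partial>lborel)
      \<le> (\<integral>\<^sup>+x. ennreal ((C * decay (x :: real ^ 'n))\<^sup>2) \<partial>lborel)"
    by (intro nn_integral_mono ennreal_leI power_mono bound) auto
  then have "(\<integral>\<^sup>+x. ennreal ((cmod (G (cpoint x 0)))\<^sup>2) \<partial>lborel) < \<infinity>"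
    using fin[of C] by (rule order_le_less_trans)
  moreover have "((\<lambda>\<eta>. \<integral>\<^sup>+ x. ennreal ((cmod (G (cpoint x \<eta>) - G (cpoint x 0)))\<^sup>2) \<partial>lborel) \<longlongrightarrow> 0)
       (at 0 within first_octant)"
    unfolding tendsto_at_iff_sequentially
  proof (intro allI impI)
    fix X :: "nat \<Rightarrow> real ^ 'n" assume X: "\<forall>i. X i \<in> first_octant - {0}" "X \<longlonglongrightarrow> 0"
    have Xn: "X i $ k \<ge> 0" for i k using X(1) by (auto intro: first_octant_nonneg)
    have [measurable]: "(\<lambda>x. G (cpoint x (X i))) \<in> borel_measurable borel" for i
      using decaying_measurable[OF assms] Xn by blast
    have "(\<lambda>i. \<integral>\<^sup>+ x. ennreal ((cmod (G (cpoint x (X i)) - G (cpoint x 0)))\<^sup>2) \<partial>lborel)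
      \<longlonglongrightarrow> (\<integral>\<^sup>+ (x :: real ^ 'n). 0 \<partial>lborel)"
    proof (rule nn_integral_dominated_convergence[where w = "\<lambda>x. ennreal ((2 * C * decay x)\<^sup>2)"])
      show "AE x in lborel. ennreal ((cmod (G (cpoint x (X i)) - G (cpoint x 0)))\<^sup>2)
          \<le> ennreal ((2 * C * decay x)\<^sup>2)" for i
      proof (intro AE_I2 ennreal_leI power_mono)
        fix x
        show "cmod (G (cpoint x (X i)) - G (cpoint x 0)) \<le> 2 * C * decay x"
          using norm_triangle_ineq4[of "G (cpoint x (X i))" "G (cpoint x 0)"]
            bound[of "X i" x, OF Xn] bound[of 0 x] by simp
      qed simp
      show "AE x in lborel. (\<lambda>i. ennreal ((cmod (G (cpoint x (X i)) - G (cpoint x 0)))\<^sup>2)) \<longlonglongrightarrow> 0"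
      proof (intro AE_I2)
        fix x :: "real ^ 'n"
        have cont: "continuous_on {y. \<forall>k. y $ k \<ge> 0} (\<lambda>y. G (cpoint x y))"
        proof (rule continuous_on_compose2[of "half_space \<delta>" G])
          show "continuous_on (half_space \<delta>) G" using d by (simp add: decaying_on_def)
          show "continuous_on {y. \<forall>k. y $ k \<ge> 0} (\<lambda>y. cpoint x y)" by (intro continuous_intros)
          show "(\<lambda>y. cpoint x y) ` {y. \<forall>k. y $ k \<ge> 0} \<subseteq> half_space \<delta>"
            using cpoint_in_half_space[OF d(1)] by blast
        qed
        have "(\<lambda>i. G (cpoint x (X i))) \<longlonglongrightarrow> G (cpoint x 0)"
          by (rule continuous_on_tendsto_compose[OF cont X(2)]) (auto simp: Xn)
        then have "(\<lambda>i. (cmod (G (cpoint x (X i)) - G (cpoint x 0)))\<^sup>2) \<longlonglongrightarrow> (cmod (G (cpoint x 0) - G (cpoint x 0)))\<^sup>2"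
          by (intro tendsto_intros)
        then show "(\<lambda>i. ennreal ((cmod (G (cpoint x (X i)) - G (cpoint x 0)))\<^sup>2)) \<longlonglongrightarrow> 0"
          using tendsto_ennrealI by fastforce
      qed
    qed (use fin[of "2 * C"] in auto)
    then show "((\<lambda>\<eta>. \<integral>\<^sup>+ x. ennreal ((cmod (G (cpoint x \<eta>) - G (cpoint x 0)))\<^sup>2) \<partial>lborel) \<circ> X) \<longlonglongrightarrow> 0"
      by (simp add: o_def)
  qed
  ultimately show ?thesis by (simp add: is_boundary_limit_def)
qed

lemma decaying_hardy_norm_sq_le:
  "decaying G \<Longrightarrow> hardy_norm_sq G \<le> (\<integral>\<^sup>+x. ennreal ((cmod (G (cpoint x 0)))\<^sup>2) \<partial>lborel)"
  unfolding hardy_norm_sq_def by (rule SUP_least) (rule decaying_contraction)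

section \<open>Multiple kernels\<close>

definition cnj_vec :: "complex ^ 'n \<Rightarrow> complex ^ 'n" where
  "cnj_vec z = (\<chi> k. cnj (z $ k))"

text \<open>The multiple kernels at \<open>z\<close> are of the form \<open>f (w - cnj z)\<close> with \<open>f\<close> in the following class,
  which is closed under complex partial derivatives.\<close>

inductive polar :: "(complex ^ 'n::finite \<Rightarrow> complex) \<Rightarrow> bool" where
  monomial: "polar (\<lambda>v. \<Prod>k\<in>UNIV. inverse (v $ k) ^ Suc (p k))"
| add: "polar f \<Longrightarrow> polar g \<Longrightarrow> polar (\<lambda>v. f v + g v)"
| cmult: "polar f \<Longrightarrow> polar (\<lambda>v. c * f v)"

lemma polar_zero: "polar (\<lambda>v. 0)"
  using polar.cmult[OF polar.monomial, of 0] by simp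

lemma polar_sum: "finite A \<Longrightarrow> (\<And>i. i \<in> A \<Longrightarrow> polar (f i)) \<Longrightarrow> polar (\<lambda>v. \<Sum>i\<in>A. f i v)"
  by (induction A rule: finite_induct) (auto intro: polar_zero polar.add)

lemma polar_partial:
  fixes f :: "complex ^ 'n \<Rightarrow> complex"
  assumes "polar f"
  shows "\<exists>f'. polar f' \<and> (\<forall>v. (\<forall>k. v $ k \<noteq> 0) \<longrightarrow>
    ((\<lambda>s. f (v + s *s axis j 1)) has_field_derivative f' v) (at 0))"
  using assms
proof (induction rule: polar.induct)
  case (monomial p)
  define q where "q = p(j := Suc (p j))"
  define f' :: "complex ^ 'n \<Rightarrow> complex" where
    "f' v = - of_nat (Suc (p j)) * (\<Prod>k\<in>UNIV. inverse (v $ k) ^ Suc (q k))" for v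
  have "((\<lambda>s. \<Prod>k\<in>UNIV. inverse ((v + s *s axis j 1) $ k) ^ Suc (p k)) has_field_derivative f' v) (at 0)"
    if v: "\<forall>k. v $ k \<noteq> 0" for v :: "complex ^ 'n"
  proof -
    let ?r = "\<Prod>k\<in>UNIV - {j}. inverse (v $ k) ^ Suc (p k)"
    have 1: "(\<Prod>k\<in>UNIV. inverse ((v + s *s axis j 1) $ k) ^ Suc (p k)) = inverse (v $ j + s) ^ Suc (p j) * ?r" for s
    proof -
      have "(\<Prod>k\<in>UNIV - {j}. inverse ((v + s *s axis j 1) $ k) ^ Suc (p k)) = ?r"
        by (intro prod.cong) (auto simp: axis_def)
      then show ?thesis by (subst prod.remove[of UNIV j]) (auto simp: axis_def)
    qed
    have "(\<Prod>k\<in>UNIV - {j}. inverse (v $ k) ^ Suc (q k)) = ?r"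
      by (intro prod.cong) (auto simp: q_def)
    then have 2: "f' v = - of_nat (Suc (p j)) * (inverse (v $ j) ^ Suc (Suc (p j)) * ?r)"
      unfolding f'_def by (subst prod.remove[of UNIV j]) (auto simp: q_def)
    have vj: "v $ j \<noteq> 0" using v by blast
    have "((\<lambda>s. inverse (v $ j + s) ^ Suc (p j)) has_field_derivative
        of_nat (Suc (p j)) * (- (inverse (v $ j) * inverse (v $ j))) * inverse (v $ j) ^ p j) (at 0)"
      using vj by (auto intro!: derivative_eq_intros simp del: power_Suc simp: power2_eq_square)
    from DERIV_cmult_right[OF this, of ?r] show ?thesis
      unfolding 1 2 by (simp add: algebra_simps)
  qed
  moreover have "polar f'" unfolding f'_def[abs_def] by (intro polar.cmult polar.monomial)
  ultimately show ?case by blast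
next
  case (add f g)
  then obtain f' g' where "polar f'" "polar g'"
    "\<And>v. \<forall>k. v $ k \<noteq> 0 \<Longrightarrow> ((\<lambda>s. f (v + s *s axis j 1)) has_field_derivative f' v) (at 0)"
    "\<And>v. \<forall>k. v $ k \<noteq> 0 \<Longrightarrow> ((\<lambda>s. g (v + s *s axis j 1)) has_field_derivative g' v) (at 0)"
    by blast
  then show ?case
    by (intro exI[of _ "\<lambda>v. f' v + g' v"]) (auto intro: polar.add DERIV_add)
next
  case (cmult f c)
  then obtain f' where "polar f'"
    "\<And>v. \<forall>k. v $ k \<noteq> 0 \<Longrightarrow> ((\<lambda>s. f (v + s *s axis j 1)) has_field_derivative f' v) (at 0)"
    by blast
  then show ?case
    by (intro exI[of _ "\<lambda>v. c * f' v"]) (auto intro: polar.cmult DERIV_cmult)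
qed

text \<open>The expression \<open>f (w - cnj_vec u)\<close> is antiholomorphic in u: moving
  coordinate j of u by t c moves the argument by - t times the conjugate of c. The directions 1 and
  \<i> give the derivatives - D and \<i> D, which the Wirtinger formula combines to - D.\<close>

lemma wirtinger_bar_conj:
  fixes f :: "complex ^ 'n \<Rightarrow> complex"
  assumes deriv: "((\<lambda>s. f (w - cnj_vec u + s *s axis j 1)) has_field_derivative D) (at 0)"
    and nz: "\<And>k. w $ k \<noteq> cnj (u $ k)"
    and eq: "\<And>u'. (\<And>k. w $ k \<noteq> cnj (u' $ k)) \<Longrightarrow> g u' = f (w - cnj_vec u')"
  shows "wirtinger_bar j g u = - D"
proof -
  have *: "((\<lambda>t::real. g (u + t *\<^sub>R axis j c)) has_vector_derivative - cnj c * D) (at 0)" for c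
  proof (rule has_vector_derivative_transform_within_open)
    have "((\<lambda>t::real. of_real t * (- cnj c)) has_vector_derivative 1 * (- cnj c)) (at 0)"
      using has_vector_derivative_mult_left[OF has_vector_derivative_of_real[OF DERIV_ident], of "- cnj c"] by simp
    from field_vector_diff_chain_at[OF this, of "\<lambda>s. f (w - cnj_vec u + s *s axis j 1)" D]
    have "((\<lambda>t::real. f (w - cnj_vec u + (of_real t * (- cnj c)) *s axis j 1)) has_vector_derivative - cnj c * D) (at 0)"
      using deriv by (simp add: o_def)
    moreover have pt: "w - cnj_vec u + (of_real t * (- cnj c)) *s axis j 1 = w - cnj_vec (u + t *\<^sub>R axis j c)" for t
      by (simp add: vec_eq_iff cnj_vec_def axis_def complex_eq_iff)
    ultimately show "((\<lambda>t::real. f (w - cnj_vec (u + t *\<^sub>R axis j c))) has_vector_derivative - cnj c * D) (at 0)"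
      unfolding pt by blast
    \<comment> \<open>g is known only off the poles; the parameters t avoiding them form a
      neighbourhood of 0, which suffices for the derivative.\<close>
    let ?S = "\<Inter>k. {t::real. w $ k \<noteq> cnj ((u + t *\<^sub>R axis j c) $ k)}"
    show "open ?S"
      by (intro open_INT ballI open_Collect_neq continuous_intros) auto
    show "0 \<in> ?S" using nz by simp
    show "f (w - cnj_vec (u + t *\<^sub>R axis j c)) = g (u + t *\<^sub>R axis j c)" if "t \<in> ?S" for t
      using that by (intro eq[symmetric]) auto
  qed
  show ?thesis
    unfolding wirtinger_bar_def
    using vector_derivative_at[OF *[of 1]] vector_derivative_at[OF *[of \<i>]]
    by (simp add: mult.assoc[symmetric])
qed

text \<open>A single \<open>f'\<close> serves all g, w and u, and g is compared with f only off the
  poles. Both features let the statement be iterated.\<close>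

lemma polar_dir_nabla:
  fixes f :: "complex ^ 'n \<Rightarrow> complex"
  assumes "polar f"
  shows "\<exists>f'. polar f' \<and> (\<forall>g w u. (\<forall>k. w $ k \<noteq> cnj (u $ k)) \<longrightarrow>
    (\<forall>u'. (\<forall>k. w $ k \<noteq> cnj (u' $ k)) \<longrightarrow> g u' = f (w - cnj_vec u')) \<longrightarrow>
    dir_nabla d g u = f' (w - cnj_vec u))"
proof -
  obtain h where h: "\<And>j. polar (h j)"
    "\<And>j v. \<forall>k. v $ k \<noteq> 0 \<Longrightarrow> ((\<lambda>s. f (v + s *s axis j 1)) has_field_derivative h j v) (at 0)"
    using polar_partial[OF assms] by metis
  have "dir_nabla d g u = (\<Sum>j\<in>UNIV. (- (d $ j)) * h j (w - cnj_vec u))"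
    if nz: "\<forall>k. w $ k \<noteq> cnj (u $ k)"
      and eq: "\<forall>u'. (\<forall>k. w $ k \<noteq> cnj (u' $ k)) \<longrightarrow> g u' = f (w - cnj_vec u')" for g w u
  proof -
    have "((\<lambda>s. f (w - cnj_vec u + s *s axis j 1)) has_field_derivative h j (w - cnj_vec u)) (at 0)" for j
      using nz by (intro h(2)) (auto simp: cnj_vec_def)
    from wirtinger_bar_conj[OF this] nz eq
    have "wirtinger_bar j g u = - h j (w - cnj_vec u)" for j by blast
    then show ?thesis by (simp add: dir_nabla_def)
  qed
  moreover have "polar (\<lambda>v. \<Sum>j\<in>UNIV. (- (d $ j)) * h j v)"
    by (intro polar_sum polar.cmult h) auto
  ultimately show ?thesis by (intro exI[of _ "\<lambda>v. \<Sum>j\<in>UNIV. (- (d $ j)) * h j v"]) blast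
qed

lemma polar_iterated_kernel:
  fixes d :: "complex ^ 'n"
  shows "\<exists>f. polar f \<and> (\<forall>w u. (\<forall>k. w $ k \<noteq> cnj (u $ k)) \<longrightarrow>
    (dir_nabla d ^^ l) (\<lambda>u. kernel u w) u = f (w - cnj_vec u))"
proof (induction l)
  case 0
  let ?c = "\<Prod>k\<in>(UNIV :: 'n set). - 1 / (2 * of_real pi * \<i>) :: complex"
  have "kernel u w = ?c * (\<Prod>k\<in>UNIV. inverse ((w - cnj_vec u) $ k) ^ Suc 0)" for u w :: "complex ^ 'n"
    unfolding kernel_def prod.distrib[symmetric]
    by (intro prod.cong) (auto simp: cnj_vec_def field_simps)
  moreover have "polar (\<lambda>v. ?c * (\<Prod>k\<in>UNIV. inverse (v $ k) ^ Suc 0))"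
    by (intro polar.cmult polar.monomial)
  ultimately show ?case by (intro exI[of _ "\<lambda>v. ?c * (\<Prod>k\<in>UNIV. inverse (v $ k) ^ Suc 0)"]) simp
next
  case (Suc l)
  then obtain f where f: "polar f" "\<And>w u. \<forall>k. w $ k \<noteq> cnj (u $ k) \<Longrightarrow>
    (dir_nabla d ^^ l) (\<lambda>u. kernel u w) u = f (w - cnj_vec u)" by blast
  obtain f' where f': "polar f'"
    "\<And>g w u. \<forall>k. w $ k \<noteq> cnj (u $ k) \<Longrightarrow>
    (\<forall>u'. (\<forall>k. w $ k \<noteq> cnj (u' $ k)) \<longrightarrow> g u' = f (w - cnj_vec u')) \<Longrightarrow>
    dir_nabla d g u = f' (w - cnj_vec u)"
    using polar_dir_nabla[OF f(1), of d] by blast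
  have "(dir_nabla d ^^ Suc l) (\<lambda>u. kernel u w) u = f' (w - cnj_vec u)"
    if nz: "\<forall>k. w $ k \<noteq> cnj (u $ k)" for w u
    unfolding funpow.simps o_apply by (rule f'(2)[OF nz]) (use f(2) in blast)
  with f'(1) show ?case by blast
qed

section \<open>Decay of the multiple kernels\<close>

lemma set_coord_in_half_space:
  "w \<in> half_space \<delta> \<Longrightarrow> Im s > - \<delta> \<Longrightarrow> set_coord w k s \<in> half_space \<delta>"
  by (simp add: half_space_def set_coord_def)

text \<open>The closed form of a multiple kernel is established only off the poles, hence on a
  half-space rather than as an equation between total functions.\<close>

lemma decaying_cong:
  fixes f g :: "complex ^ 'n \<Rightarrow> complex"
  assumes "decaying f" "\<delta> > 0" and eq: "\<And>w. w \<in> half_space \<delta> \<Longrightarrow> f w = g w"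
  shows "decaying g"
proof -
  obtain \<delta>1 C where *: "\<delta>1 > 0" "decaying_on \<delta>1 C f"
    using assms(1) unfolding decaying_def by blast
  define e where "e = min \<delta> \<delta>1"
  have e: "e > 0" using * assms by (simp add: e_def)
  have f: "decaying_on e C f" by (rule decaying_on_mono[OF *(2)]) (simp add: e_def)
  have eq': "f w = g w" if "w \<in> half_space e" for w
    using half_space_mono[of e \<delta>] that by (intro eq) (auto simp: e_def)
  have "decaying_on e C g"
    unfolding decaying_on_def
  proof (intro conjI ballI allI)
    show "continuous_on (half_space e) g"
      using f eq' unfolding decaying_on_def by (metis (no_types, lifting) continuous_on_cong)
    fix w :: "complex ^ 'n" assume w: "w \<in> half_space e"
    show "cmod (g w) \<le> C * decay (\<chi> k. Re (w $ k))"
      using f w eq'[OF w] unfolding decaying_on_def by metis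
    fix k
    have "(\<lambda>s. f (set_coord w k s)) holomorphic_on {s. Im s > - e}"
      using f w unfolding decaying_on_def by blast
    then show "(\<lambda>s. g (set_coord w k s)) holomorphic_on {s. Im s > - e}"
      by (rule holomorphic_transform) (simp add: eq' set_coord_in_half_space w)
  qed
  then show ?thesis using e unfolding decaying_def by blast
qed

text \<open>The poles lie at depth at least 2 \<delta>, so they keep distance \<delta> from
  \<open>half_space \<delta>\<close>. In each variable one inverse is spent on decay, and the
  remaining \<open>p k\<close> of them are bounded by \<open>1 / \<delta>\<close>.\<close>

lemma decaying_monomial:
  fixes z :: "complex ^ 'n"
  assumes \<delta>: "\<delta> > 0" "\<And>k. Im (z $ k) \<ge> 2 * \<delta>"
  shows "decaying (\<lambda>w. \<Prod>k\<in>UNIV. inverse ((w - cnj_vec z) $ k) ^ Suc (p k))"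
proof -
  \<comment> \<open>With r the distance to the pole, \<open>1 + \<bar>Re s\<bar>\<close> is at most
    \<open>(1 + \<bar>Re (z $ k)\<bar>) + r\<close>; replacing the 1 hidden in the first summand by
    \<open>r / \<delta>\<close> makes the whole a multiple of r, with the second factor
    here.\<close>
  define A where "A k = (1 / \<delta>) ^ p k * ((1 + \<bar>Re (z $ k)\<bar>) / \<delta> + 1)" for k
  have far: "cmod (s - cnj (z $ k)) \<ge> \<delta>" if "Im s > - \<delta>" for s k
    using abs_Im_le_cmod[of "s - cnj (z $ k)"] that \<delta>(2)[of k] by simp
  have nz: "s - cnj (z $ k) \<noteq> 0" if "Im s > - \<delta>" for s k
    using far[OF that, of k] \<delta>(1) by auto
  have factor: "cmod (inverse (s - cnj (z $ k)) ^ Suc (p k)) \<le> A k * (1 / (1 + \<bar>Re s\<bar>))"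
    if s: "Im s > - \<delta>" for s k
  proof -
    define r where "r = cmod (s - cnj (z $ k))"
    have r: "r \<ge> \<delta>" "r > 0" using far[OF s, of k] \<delta>(1) by (auto simp: r_def)
    have "\<bar>Re s\<bar> \<le> \<bar>Re (z $ k)\<bar> + r"
      using abs_Re_le_cmod[of "s - cnj (z $ k)"] by (simp add: r_def)
    then have "1 + \<bar>Re s\<bar> \<le> (1 + \<bar>Re (z $ k)\<bar>) * 1 + r" by simp
    also have "\<dots> \<le> (1 + \<bar>Re (z $ k)\<bar>) * (r / \<delta>) + r"
      using r \<delta>(1) by (intro add_mono mult_left_mono) auto
    also have "\<dots> = ((1 + \<bar>Re (z $ k)\<bar>) / \<delta> + 1) * r" by (simp add: field_simps)
    finally have 1: "inverse r \<le> ((1 + \<bar>Re (z $ k)\<bar>) / \<delta> + 1) * (1 / (1 + \<bar>Re s\<bar>))"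
      using r by (simp add: field_simps)
    have 2: "inverse r \<le> 1 / \<delta>" using r \<delta>(1) by (simp add: field_simps)
    have "cmod (inverse (s - cnj (z $ k)) ^ Suc (p k)) = inverse r ^ p k * inverse r"
      by (simp add: norm_power norm_inverse r_def norm_mult mult.commute)
    also have "\<dots> \<le> (1 / \<delta>) ^ p k * (((1 + \<bar>Re (z $ k)\<bar>) / \<delta> + 1) * (1 / (1 + \<bar>Re s\<bar>)))"
      using 1 2 r \<delta>(1) by (intro mult_mono power_mono) auto
    finally show ?thesis by (simp add: A_def mult.assoc)
  qed
  have "decaying_on \<delta> (\<Prod>k\<in>UNIV. A k) (\<lambda>w. \<Prod>k\<in>UNIV. inverse ((w - cnj_vec z) $ k) ^ Suc (p k))"
    unfolding decaying_on_def
  proof (intro conjI ballI allI)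
    show "continuous_on (half_space \<delta>) (\<lambda>w. \<Prod>k\<in>UNIV. inverse ((w - cnj_vec z) $ k) ^ Suc (p k))"
      by (intro continuous_on_prod continuous_on_power continuous_on_inverse continuous_intros)
        (use nz in \<open>auto simp: half_space_def cnj_vec_def\<close>)
    fix w :: "complex ^ 'n" assume w: "w \<in> half_space \<delta>"
    have "(\<lambda>s. inverse ((set_coord w k s - cnj_vec z) $ j) ^ Suc (p j)) holomorphic_on {s. Im s > - \<delta>}" for k j
    proof (cases "j = k")
      case True
      then show ?thesis using nz
        by (auto simp: set_coord_def cnj_vec_def simp del: power_Suc intro!: holomorphic_intros)
    qed (auto simp: set_coord_def)
    then show "(\<lambda>s. \<Prod>j\<in>UNIV. inverse ((set_coord w k s - cnj_vec z) $ j) ^ Suc (p j))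
        holomorphic_on {s. Im s > - \<delta>}" for k
      by (intro holomorphic_on_prod)
    have "cmod (\<Prod>k\<in>UNIV. inverse ((w - cnj_vec z) $ k) ^ Suc (p k)) =
        (\<Prod>k\<in>UNIV. cmod (inverse (w $ k - cnj (z $ k)) ^ Suc (p k)))"
      by (simp add: cnj_vec_def del: power_Suc flip: prod_norm)
    also have "\<dots> \<le> (\<Prod>k\<in>UNIV. A k * (1 / (1 + \<bar>Re (w $ k)\<bar>)))"
      using w by (intro prod_mono conjI factor norm_ge_zero) (auto simp: half_space_def)
    also have "\<dots> = (\<Prod>k\<in>UNIV. A k) * decay (\<chi> k. Re (w $ k))"
      by (simp add: prod.distrib decay_def prod_dividef)
    finally show "cmod (\<Prod>k\<in>UNIV. inverse ((w - cnj_vec z) $ k) ^ Suc (p k)) \<le>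
        (\<Prod>k\<in>UNIV. A k) * decay (\<chi> k. Re (w $ k))" .
  qed
  then show ?thesis using \<delta>(1) unfolding decaying_def by blast
qed

lemma polar_decaying:
  assumes "polar f" "\<delta> > 0" "\<And>k. Im (z $ k) \<ge> 2 * \<delta>"
  shows "decaying (\<lambda>w. f (w - cnj_vec z))"
  using assms(1)
proof (induction rule: polar.induct)
  case (monomial p)
  show ?case by (rule decaying_monomial[OF assms(2,3)])
qed (auto intro: decaying_add decaying_cmult)

lemma tube_iff: "z \<in> tube \<longleftrightarrow> (\<forall>k. Im (z $ k) > 0)"
proof
  assume "\<forall>k. Im (z $ k) > 0"
  then have "z = cpoint (\<chi> k. Re (z $ k)) (\<chi> k. Im (z $ k))" "(\<chi> k. Im (z $ k)) \<in> first_octant"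
    by (auto simp: cpoint_def first_octant_def vec_eq_iff)
  then show "z \<in> tube" unfolding tube_def by blast
qed (auto simp: tube_def cpoint_def first_octant_def)

lemma decaying_iterated_kernel:
  fixes z :: "complex ^ 'n"
  assumes "z \<in> tube"
  shows "decaying (\<lambda>w. (dir_nabla d ^^ l) (\<lambda>u. kernel u w) z)"
proof -
  define \<delta> where "\<delta> = Min (range (\<lambda>k. Im (z $ k))) / 2"
  have "Min (range (\<lambda>k. Im (z $ k))) > 0"
    using assms by (subst Min_gr_iff) (auto simp: tube_iff)
  then have \<delta>: "\<delta> > 0" by (simp add: \<delta>_def)
  have ge: "Im (z $ k) \<ge> 2 * \<delta>" for k by (simp add: \<delta>_def)
  obtain f where f: "polar f" "\<And>w u. \<forall>k. w $ k \<noteq> cnj (u $ k) \<Longrightarrow>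
    (dir_nabla d ^^ l) (\<lambda>u. kernel u w) u = f (w - cnj_vec u)"
    using polar_iterated_kernel[where d = d and l = l] by blast
  show ?thesis
  proof (rule decaying_cong[OF polar_decaying[OF f(1) \<delta> ge] \<delta>])
    fix w :: "complex ^ 'n" assume "w \<in> half_space \<delta>"
    then have "w $ k \<noteq> cnj (z $ k)" for k
      using ge[of k] \<delta> by (auto simp: half_space_def complex_eq_iff dest!: spec[of _ k])
    then show "f (w - cnj_vec z) = (dir_nabla d ^^ l) (\<lambda>u. kernel u w) z"
      using f(2) by simp
  qed
qed

lemma decaying_kernel: "z \<in> tube \<Longrightarrow> decaying (kernel z)"
  using decaying_iterated_kernel[where l = 0] by simp

lemma decaying_multiple_kernel: "z k \<in> tube \<Longrightarrow> decaying (multiple_kernel d z k)"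
  unfolding multiple_kernel_def[abs_def]
  by (intro decaying_cmult decaying_iterated_kernel)

section \<open>Square integrable functions and boundary limits\<close>

definition l2_sq :: "('a::euclidean_space \<Rightarrow> complex) \<Rightarrow> ennreal" where
  "l2_sq f = (\<integral>\<^sup>+ x. ennreal ((cmod (f x))\<^sup>2) \<partial>lborel)"

text \<open>A substitute for the triangle inequality that needs no square roots of extended reals: the
  factor \<open>1 + e\<close> disappears in the limit.\<close>

lemma norm_add_sq_le:
  fixes a b :: "'a::real_normed_vector"
  assumes "e > 0"
  shows "(norm (a + b))\<^sup>2 \<le> (1 + e) * (norm a)\<^sup>2 + (1 + 1 / e) * (norm b)\<^sup>2"
proof -
  have "(norm (a + b))\<^sup>2 \<le> (norm a + norm b)\<^sup>2"
    by (intro power_mono norm_triangle_ineq) auto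
  also have "\<dots> = (1 + e) * (norm a)\<^sup>2 + (1 + 1 / e) * (norm b)\<^sup>2 - (e * norm a - norm b)\<^sup>2 / e"
    using assms by (simp add: field_simps power2_eq_square)
  also have "\<dots> \<le> (1 + e) * (norm a)\<^sup>2 + (1 + 1 / e) * (norm b)\<^sup>2"
    using assms by simp
  finally show ?thesis .
qed

lemma l2_sq_add_le:
  assumes [measurable]: "f \<in> borel_measurable borel" "g \<in> borel_measurable borel" and "e > 0"
  shows "l2_sq (\<lambda>x. f x + g x) \<le> ennreal (1 + e) * l2_sq f + ennreal (1 + 1 / e) * l2_sq g"
proof -
  have "l2_sq (\<lambda>x. f x + g x) \<le>
    (\<integral>\<^sup>+ x. ennreal (1 + e) * ennreal ((cmod (f x))\<^sup>2) + ennreal (1 + 1 / e) * ennreal ((cmod (g x))\<^sup>2) \<partial>lborel)"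
    unfolding l2_sq_def
  proof (rule nn_integral_mono)
    fix x
    have "ennreal ((cmod (f x + g x))\<^sup>2) \<le> ennreal ((1 + e) * (cmod (f x))\<^sup>2 + (1 + 1 / e) * (cmod (g x))\<^sup>2)"
      by (intro ennreal_leI norm_add_sq_le \<open>e > 0\<close>)
    also have "\<dots> = ennreal (1 + e) * ennreal ((cmod (f x))\<^sup>2) + ennreal (1 + 1 / e) * ennreal ((cmod (g x))\<^sup>2)"
      using \<open>e > 0\<close> by (simp add: ennreal_mult)
    finally show "ennreal ((cmod (f x + g x))\<^sup>2) \<le>
      ennreal (1 + e) * ennreal ((cmod (f x))\<^sup>2) + ennreal (1 + 1 / e) * ennreal ((cmod (g x))\<^sup>2)" .
  qed
  also have "\<dots> = ennreal (1 + e) * l2_sq f + ennreal (1 + 1 / e) * l2_sq g"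
    by (simp add: nn_integral_add nn_integral_cmult l2_sq_def)
  finally show ?thesis .
qed

lemma l2_sq_cmult:
  assumes [measurable]: "f \<in> borel_measurable borel"
  shows "l2_sq (\<lambda>x. c * f x) = ennreal ((cmod c)\<^sup>2) * l2_sq f"
  unfolding l2_sq_def by (simp add: norm_mult power_mult_distrib ennreal_mult nn_integral_cmult)

lemma l2_sq_minus_commute: "l2_sq (\<lambda>x. f x - g x) = l2_sq (\<lambda>x. g x - f x)"
  unfolding l2_sq_def by (simp add: norm_minus_commute)

lemma ennreal_le_of_le_mult:
  fixes a b :: ennreal
  assumes "\<And>e. e > 0 \<Longrightarrow> a \<le> ennreal (1 + e) * b"
  shows "a \<le> b"
proof (cases "b = top")
  case False
  have "(\<lambda>n. b * ennreal (1 + 1 / real (Suc n))) \<longlonglongrightarrow> b * ennreal (1 + 0)"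
    using False
    by (intro ennreal_tendsto_cmult tendsto_ennrealI tendsto_add tendsto_const LIMSEQ_Suc[OF lim_1_over_n])
      (simp add: top.not_eq_extremum)
  then have "a \<le> b * ennreal (1 + 0)"
    by (rule LIMSEQ_le_const) (use assms in \<open>auto simp: mult.commute\<close>)
  then show ?thesis by simp
qed simp

text \<open>A series with weights \<open>2 ^ j\<close> dominates the increments, so that the sequence converges almost
  everywhere; Fatou's lemma then bounds the distance to the limit.\<close>

lemma l2_complete:
  fixes h :: "nat \<Rightarrow> 'a::euclidean_space \<Rightarrow> complex"
  assumes [measurable]: "\<And>j. h j \<in> borel_measurable borel"
    and C: "C \<ge> 0" and cauchy: "\<And>j k. j \<le> k \<Longrightarrow> l2_sq (\<lambda>x. h k x - h j x) \<le> ennreal (C * (1/8) ^ j)"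
  obtains g where "g \<in> borel_measurable borel" "\<And>j. l2_sq (\<lambda>x. g x - h j x) \<le> ennreal (C * (1/8) ^ j)"
proof
  \<comment> \<open>The ratio 1/8 of the hypothesis leaves room for the weight: the integrals of
    \<open>u j\<close> are at most \<open>C * (1/4) ^ j\<close>.\<close>
  define u where "u j x = 2 ^ j * (cmod (h (Suc j) x - h j x))\<^sup>2" for j x
  have um [measurable]: "u j \<in> borel_measurable borel" for j unfolding u_def[abs_def] by measurable
  have u0: "u j x \<ge> 0" for j x by (simp add: u_def)
  define g where "g x = lim (\<lambda>n. h n x)" for x
  show gm [measurable]: "g \<in> borel_measurable borel"
    unfolding g_def[abs_def] by (intro borel_measurable_lim_metric) measurable
  have "(\<integral>\<^sup>+ x. (\<Sum>j. ennreal (u j x)) \<partial>lborel) = (\<Sum>j. \<integral>\<^sup>+ x. ennreal (u j x) \<partial>lborel)"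
    by (intro nn_integral_suminf) measurable
  also have "\<dots> \<le> (\<Sum>j. ennreal (C * (1/4) ^ j))"
  proof (intro suminf_le allI)
    fix j
    have "(\<integral>\<^sup>+ x. ennreal (u j x) \<partial>lborel) = ennreal (2 ^ j) * l2_sq (\<lambda>x. h (Suc j) x - h j x)"
      unfolding u_def l2_sq_def by (simp add: ennreal_mult nn_integral_cmult)
    also have "\<dots> \<le> ennreal (2 ^ j) * ennreal (C * (1/8) ^ j)"
      by (intro mult_left_mono cauchy) auto
    also have "\<dots> = ennreal (C * (1/4) ^ j)"
      using C by (simp add: ennreal_mult[symmetric] power_mult_distrib[symmetric] mult.left_commute
          flip: ennreal_mult)
    finally show "(\<integral>\<^sup>+ x. ennreal (u j x) \<partial>lborel) \<le> ennreal (C * (1/4) ^ j)" .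
  qed auto
  also have "\<dots> < top"
    using C by (subst suminf_ennreal2) (auto intro!: summable_mult summable_geometric)
  finally have "AE x in lborel. (\<Sum>j. ennreal (u j x)) \<noteq> \<infinity>"
    by (intro nn_integral_PInf_AE) auto
  then have conv: "AE x in lborel. (\<lambda>n. h n x) \<longlonglongrightarrow> g x"
  proof eventually_elim
    case (elim x)
    then have su: "summable (\<lambda>j. u j x)" by (intro summable_suminf_not_top u0) auto
    have "summable (\<lambda>j. h (Suc j) x - h j x)"
    proof (rule summable_comparison_test)
      show "summable (\<lambda>j. (1/2) ^ j + u j x)"
        using su by (intro summable_add summable_geometric) auto
      have "cmod (h (Suc j) x - h j x) \<le> (1/2) ^ j + u j x" for j
      proof -
        define r where "r = cmod (h (Suc j) x - h j x)"
        \<comment> \<open>The inequality of arithmetic and geometric means turns summable weighted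
          squares into absolutely summable increments.\<close>
        have "0 \<le> ((1/2) ^ j - r)\<^sup>2 * 2 ^ j" by simp
        also have "\<dots> = (1/2) ^ j + u j x - 2 * r"
          unfolding u_def r_def[symmetric] power_one_over
          by (simp add: power2_eq_square field_simps)
        finally show ?thesis using norm_ge_zero[of "h (Suc j) x - h j x"] unfolding r_def by linarith
      qed
      then show "\<exists>N. \<forall>j\<ge>N. norm (h (Suc j) x - h j x) \<le> (1/2) ^ j + u j x" by blast
    qed
    then have "convergent (\<lambda>n. \<Sum>j<n. h (Suc j) x - h j x)"
      by (simp add: summable_iff_convergent)
    then have "convergent (\<lambda>n. (\<Sum>j<n. h (Suc j) x - h j x) + h 0 x)"
      by (intro convergent_add convergent_const)
    then show ?case
      unfolding sum_lessThan_telescope[where f = "\<lambda>j. h j x"]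
      by (simp add: g_def convergent_LIMSEQ_iff)
  qed
  show "l2_sq (\<lambda>x. g x - h j x) \<le> ennreal (C * (1/8) ^ j)" for j
  proof -
    have "l2_sq (\<lambda>x. g x - h j x) = (\<integral>\<^sup>+ x. liminf (\<lambda>n. ennreal ((cmod (h n x - h j x))\<^sup>2)) \<partial>lborel)"
      unfolding l2_sq_def
    proof (rule nn_integral_cong_AE)
      show "AE x in lborel. ennreal ((cmod (g x - h j x))\<^sup>2) = liminf (\<lambda>n. ennreal ((cmod (h n x - h j x))\<^sup>2))"
        using conv
      proof eventually_elim
        case (elim x)
        have "(\<lambda>n. ennreal ((cmod (h n x - h j x))\<^sup>2)) \<longlonglongrightarrow> ennreal ((cmod (g x - h j x))\<^sup>2)"
          by (intro tendsto_ennrealI tendsto_intros elim)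
        then show ?case by (intro lim_imp_Liminf[symmetric]) auto
      qed
    qed
    also have "\<dots> \<le> liminf (\<lambda>n. l2_sq (\<lambda>x. h n x - h j x))"
      unfolding l2_sq_def by (intro nn_integral_liminf) measurable
    also have "\<dots> \<le> liminf (\<lambda>n. ennreal (C * (1/8) ^ j))"
      by (intro Liminf_mono eventually_sequentiallyI[of j] cauchy)
    also have "\<dots> = ennreal (C * (1/8) ^ j)" by (simp add: Liminf_const)
    finally show ?thesis .
  qed
qed

section \<open>Slices and the Hardy norm\<close>

definition slice_measurable :: "(complex ^ 'n::finite \<Rightarrow> complex) \<Rightarrow> bool" where
  "slice_measurable F \<longleftrightarrow> (\<forall>y\<in>first_octant. (\<lambda>x. F (cpoint x y)) \<in> borel_measurable borel)"

lemma slice_measurableD: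
  "slice_measurable F \<Longrightarrow> y \<in> first_octant \<Longrightarrow> (\<lambda>x. F (cpoint x y)) \<in> borel_measurable borel"
  by (simp add: slice_measurable_def)

lemma slice_measurable_add:
  "slice_measurable F \<Longrightarrow> slice_measurable G \<Longrightarrow> slice_measurable (\<lambda>w. F w + G w)"
  unfolding slice_measurable_def by (auto intro: borel_measurable_add)

lemma slice_measurable_cmult: "slice_measurable F \<Longrightarrow> slice_measurable (\<lambda>w. c * F w)"
  unfolding slice_measurable_def by (auto intro: borel_measurable_times)

lemma slice_measurable_diff:
  "slice_measurable F \<Longrightarrow> slice_measurable G \<Longrightarrow> slice_measurable (\<lambda>w. F w - G w)"
  unfolding slice_measurable_def by (auto intro: borel_measurable_diff)

lemma slice_measurable_decaying: "decaying H \<Longrightarrow> slice_measurable H"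
  unfolding slice_measurable_def using decaying_measurable first_octant_nonneg by blast

lemma hardy_norm_sq_eq: "hardy_norm_sq F = (SUP y\<in>first_octant. l2_sq (\<lambda>x. F (cpoint x y)))"
  by (simp add: hardy_norm_sq_def l2_sq_def)

lemma l2_sq_le_hardy_norm_sq: "y \<in> first_octant \<Longrightarrow> l2_sq (\<lambda>x. F (cpoint x y)) \<le> hardy_norm_sq F"
  unfolding hardy_norm_sq_eq by (rule SUP_upper)

lemma hardy_norm_sq_add_le:
  assumes "slice_measurable F" "slice_measurable G" "e > 0"
  shows "hardy_norm_sq (\<lambda>w. F w + G w) \<le>
    ennreal (1 + e) * hardy_norm_sq F + ennreal (1 + 1 / e) * hardy_norm_sq G"
  unfolding hardy_norm_sq_eq[of "\<lambda>w. F w + G w"]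
proof (rule SUP_least)
  fix y :: "real ^ 'a" assume y: "y \<in> first_octant"
  have "l2_sq (\<lambda>x. F (cpoint x y) + G (cpoint x y)) \<le>
    ennreal (1 + e) * l2_sq (\<lambda>x. F (cpoint x y)) + ennreal (1 + 1 / e) * l2_sq (\<lambda>x. G (cpoint x y))"
    by (rule l2_sq_add_le[OF slice_measurableD[OF assms(1) y] slice_measurableD[OF assms(2) y] assms(3)])
  also have "\<dots> \<le> ennreal (1 + e) * hardy_norm_sq F + ennreal (1 + 1 / e) * hardy_norm_sq G"
    by (intro add_mono mult_left_mono l2_sq_le_hardy_norm_sq y) auto
  finally show "l2_sq (\<lambda>x. F (cpoint x y) + G (cpoint x y)) \<le> \<dots>" .
qed

lemma hardy_norm_sq_cmult_le:
  assumes "slice_measurable F"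
  shows "hardy_norm_sq (\<lambda>w. c * F w) \<le> ennreal ((cmod c)\<^sup>2) * hardy_norm_sq F"
  unfolding hardy_norm_sq_eq[of "\<lambda>w. c * F w"]
proof (rule SUP_least)
  fix y :: "real ^ 'a" assume y: "y \<in> first_octant"
  show "l2_sq (\<lambda>x. c * F (cpoint x y)) \<le> ennreal ((cmod c)\<^sup>2) * hardy_norm_sq F"
    unfolding l2_sq_cmult[OF slice_measurableD[OF assms y]]
    by (intro mult_left_mono l2_sq_le_hardy_norm_sq y) auto
qed

lemma hardy_norm_sq_minus_commute:
  "hardy_norm_sq (\<lambda>w. F w - G w) = hardy_norm_sq (\<lambda>w. G w - F w)"
  unfolding hardy_norm_sq_def by (simp add: norm_minus_commute)

lemma hardy_norm_sq_zero [simp]: "hardy_norm_sq (\<lambda>w. 0) = 0"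
  unfolding hardy_norm_sq_def by (intro antisym SUP_least) auto

text \<open>Without it convergence to the boundary could be vacuous; passing to the limit in
  inequalities, and so the uniqueness of boundary limits, rests on it.\<close>

lemma at_0_first_octant_neq_bot: "at (0 :: real ^ 'n) within first_octant \<noteq> bot"
proof -
  have "(\<lambda>n. (\<chi> k. 1 / real (Suc n)) :: real ^ 'n) \<longlonglongrightarrow> (\<chi> k. 0)"
    by (intro tendsto_vec_lambda LIMSEQ_Suc[OF lim_1_over_n])
  then have "(\<lambda>n. (\<chi> k. 1 / real (Suc n)) :: real ^ 'n) \<longlonglongrightarrow> 0"
    by (simp add: zero_vec_def)
  moreover have "(\<chi> k. 1 / real (Suc n)) \<in> (first_octant :: (real ^ 'n) set) - {0}" for n
    by (auto simp: first_octant_def vec_eq_iff)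
  ultimately have "(0 :: real ^ 'n) islimpt first_octant"
    unfolding islimpt_sequential by (intro exI[of _ "\<lambda>n. \<chi> k. 1 / real (Suc n)"]) blast
  then show ?thesis by (simp add: trivial_limit_within)
qed

section \<open>Linearity and uniqueness of boundary limits\<close>

lemma is_boundary_limit_iff: "is_boundary_limit F f \<longleftrightarrow> f \<in> borel_measurable borel \<and> l2_sq f < top \<and>
  ((\<lambda>\<eta>. l2_sq (\<lambda>x. F (cpoint x \<eta>) - f x)) \<longlongrightarrow> 0) (at 0 within first_octant)"
  by (simp add: is_boundary_limit_def l2_sq_def)

lemma eventually_in_first_octant: "\<forall>\<^sub>F y in at 0 within first_octant. y \<in> first_octant"
  by (simp add: eventually_at_filter)

lemma is_boundary_limit_add:
  assumes F: "is_boundary_limit F f" "slice_measurable F"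
    and G: "is_boundary_limit G g" "slice_measurable G"
  shows "is_boundary_limit (\<lambda>w. F w + G w) (\<lambda>x. f x + g x)"
proof -
  note m [measurable] = F(1)[unfolded is_boundary_limit_iff, THEN conjunct1]
    G(1)[unfolded is_boundary_limit_iff, THEN conjunct1]
  have "l2_sq (\<lambda>x. f x + g x) \<le> ennreal (1 + 1) * l2_sq f + ennreal (1 + 1 / 1) * l2_sq g"
    by (intro l2_sq_add_le) auto
  also have "\<dots> < top"
    using F G by (auto simp: is_boundary_limit_iff ennreal_mult_less_top)
  finally have fin: "l2_sq (\<lambda>x. f x + g x) < top" .
  have T: "((\<lambda>\<eta>. ennreal 2 * l2_sq (\<lambda>x. F (cpoint x \<eta>) - f x) + ennreal 2 * l2_sq (\<lambda>x. G (cpoint x \<eta>) - g x))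
      \<longlongrightarrow> ennreal 2 * 0 + ennreal 2 * 0) (at 0 within first_octant)"
    using F G unfolding is_boundary_limit_iff
    by (intro tendsto_add ennreal_tendsto_cmult) auto
  have E: "\<forall>\<^sub>F y in at 0 within first_octant. l2_sq (\<lambda>x. F (cpoint x y) + G (cpoint x y) - (f x + g x)) \<le>
      ennreal 2 * l2_sq (\<lambda>x. F (cpoint x y) - f x) + ennreal 2 * l2_sq (\<lambda>x. G (cpoint x y) - g x)"
    using eventually_in_first_octant
  proof eventually_elim
    case (elim y)
    note [measurable] = slice_measurableD[OF F(2) elim] slice_measurableD[OF G(2) elim]
    have "l2_sq (\<lambda>x. (F (cpoint x y) - f x) + (G (cpoint x y) - g x)) \<le>
      ennreal (1 + 1) * l2_sq (\<lambda>x. F (cpoint x y) - f x) + ennreal (1 + 1 / 1) * l2_sq (\<lambda>x. G (cpoint x y) - g x)"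
      by (intro l2_sq_add_le) auto
    then show ?case by (simp add: algebra_simps)
  qed
  have "((\<lambda>\<eta>. l2_sq (\<lambda>x. F (cpoint x \<eta>) + G (cpoint x \<eta>) - (f x + g x))) \<longlongrightarrow> 0) (at 0 within first_octant)"
  proof (rule tendsto_sandwich[OF _ E tendsto_const])
    show "((\<lambda>\<eta>. ennreal 2 * l2_sq (\<lambda>x. F (cpoint x \<eta>) - f x) + ennreal 2 * l2_sq (\<lambda>x. G (cpoint x \<eta>) - g x))
      \<longlongrightarrow> 0) (at 0 within first_octant)"
      using T by simp
  qed simp
  then show ?thesis using fin m by (simp add: is_boundary_limit_iff)
qed

lemma is_boundary_limit_cmult:
  assumes F: "is_boundary_limit F f" "slice_measurable F"
  shows "is_boundary_limit (\<lambda>w. c * F w) (\<lambda>x. c * f x)"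
proof -
  note m [measurable] = F(1)[unfolded is_boundary_limit_iff, THEN conjunct1]
  have fin: "l2_sq (\<lambda>x. c * f x) < top"
    using F by (auto simp: is_boundary_limit_iff ennreal_mult_less_top l2_sq_cmult)
  have "((\<lambda>\<eta>. ennreal ((cmod c)\<^sup>2) * l2_sq (\<lambda>x. F (cpoint x \<eta>) - f x))
      \<longlongrightarrow> ennreal ((cmod c)\<^sup>2) * 0) (at 0 within first_octant)"
    using F unfolding is_boundary_limit_iff by (intro ennreal_tendsto_cmult) auto
  moreover have "\<forall>\<^sub>F y in at 0 within first_octant. ennreal ((cmod c)\<^sup>2) * l2_sq (\<lambda>x. F (cpoint x y) - f x) =
      l2_sq (\<lambda>x. c * F (cpoint x y) - c * f x)"
    using eventually_in_first_octant
  proof eventually_elim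
    case (elim y)
    note [measurable] = slice_measurableD[OF F(2) elim]
    show ?case by (subst l2_sq_cmult[symmetric]) (auto simp: algebra_simps)
  qed
  ultimately have "((\<lambda>y. l2_sq (\<lambda>x. c * F (cpoint x y) - c * f x)) \<longlongrightarrow> ennreal ((cmod c)\<^sup>2) * 0) (at 0 within first_octant)"
    by (rule Lim_transform_eventually)
  with fin show ?thesis
    using m by (simp add: is_boundary_limit_iff)
qed

lemma is_boundary_limit_diff:
  assumes "is_boundary_limit F f" "slice_measurable F" "is_boundary_limit G g" "slice_measurable G"
  shows "is_boundary_limit (\<lambda>w. F w - G w) (\<lambda>x. f x - g x)"
  using is_boundary_limit_add[OF assms(1,2) is_boundary_limit_cmult[OF assms(3,4), of "-1"]
      slice_measurable_cmult[OF assms(4)]] by simp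

text \<open>The soft half of the norm identity: f is a slice of F plus an error that vanishes near
  the boundary, and slices are bounded by the supremum.\<close>

lemma l2_sq_boundary_le:
  assumes F: "is_boundary_limit F f" "slice_measurable F"
  shows "l2_sq f \<le> hardy_norm_sq F"
proof (rule ennreal_le_of_le_mult)
  fix e :: real assume "e > 0"
  note m [measurable] = F(1)[unfolded is_boundary_limit_iff, THEN conjunct1]
  show "l2_sq f \<le> ennreal (1 + e) * hardy_norm_sq F"
  proof (rule tendsto_le[OF at_0_first_octant_neq_bot _ tendsto_const])
    have "((\<lambda>\<eta>. ennreal (1 + e) * hardy_norm_sq F + ennreal (1 + 1 / e) * l2_sq (\<lambda>x. F (cpoint x \<eta>) - f x))
      \<longlongrightarrow> ennreal (1 + e) * hardy_norm_sq F + ennreal (1 + 1 / e) * 0) (at 0 within first_octant)"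
      using F unfolding is_boundary_limit_iff by (intro tendsto_add tendsto_const ennreal_tendsto_cmult) auto
    then show "((\<lambda>\<eta>. ennreal (1 + e) * hardy_norm_sq F + ennreal (1 + 1 / e) * l2_sq (\<lambda>x. F (cpoint x \<eta>) - f x))
      \<longlongrightarrow> ennreal (1 + e) * hardy_norm_sq F) (at 0 within first_octant)"
      by simp
    show "\<forall>\<^sub>F y in at 0 within first_octant. l2_sq f \<le>
        ennreal (1 + e) * hardy_norm_sq F + ennreal (1 + 1 / e) * l2_sq (\<lambda>x. F (cpoint x y) - f x)"
      using eventually_in_first_octant
    proof eventually_elim
      case (elim y)
      note [measurable] = slice_measurableD[OF F(2) elim]
      have "l2_sq (\<lambda>x. F (cpoint x y) + (f x - F (cpoint x y))) \<le>
        ennreal (1 + e) * l2_sq (\<lambda>x. F (cpoint x y)) + ennreal (1 + 1 / e) * l2_sq (\<lambda>x. f x - F (cpoint x y))"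
        by (intro l2_sq_add_le \<open>e > 0\<close>) auto
      also have "\<dots> \<le> ennreal (1 + e) * hardy_norm_sq F + ennreal (1 + 1 / e) * l2_sq (\<lambda>x. F (cpoint x y) - f x)"
        unfolding l2_sq_minus_commute[of f]
        by (intro add_mono mult_left_mono l2_sq_le_hardy_norm_sq elim) auto
      finally show ?case by simp
    qed
  qed
qed

text \<open>The difference \<open>f - g\<close> is a boundary limit of \<open>F - F\<close>, which
  has norm zero.\<close>

lemma is_boundary_limit_unique:
  assumes F: "is_boundary_limit F f" "is_boundary_limit F g" "slice_measurable F"
  shows "AE x in lborel. f x = g x"
proof -
  note m [measurable] = F(1)[unfolded is_boundary_limit_iff, THEN conjunct1]
    F(2)[unfolded is_boundary_limit_iff, THEN conjunct1]
  have "is_boundary_limit (\<lambda>w. F w - F w) (\<lambda>x. f x - g x)"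
    by (rule is_boundary_limit_diff[OF F(1,3,2,3)])
  from l2_sq_boundary_le[OF this] have "l2_sq (\<lambda>x. f x - g x) = 0"
    by (simp add: slice_measurable_def)
  then have "AE x in lborel. ennreal ((cmod (f x - g x))\<^sup>2) = 0"
    unfolding l2_sq_def by (subst (asm) nn_integral_0_iff_AE) auto
  then show ?thesis by eventually_elim (simp add: ennreal_eq_0_iff)
qed

section \<open>The closed span and its inner product\<close>

text \<open>Distances are measured by the extended \<open>hardy_norm_sq\<close>:
  \<open>hardy_norm\<close> passes through \<open>enn2real\<close> and would report an infinite
  distance as 0. Measurable slices keep the integrals over them additive.\<close>

definition hardy_closure :: "(complex ^ 'n::finite \<Rightarrow> complex) set" where
  "hardy_closure = {F. slice_measurable F \<and>
     (\<forall>e>0. \<exists>H. decaying H \<and> hardy_norm_sq (\<lambda>w. F w - H w) \<le> ennreal e)}"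

lemma ennreal_linear_combination:
  assumes "0 \<le> a" "0 \<le> b" "0 \<le> x" "0 \<le> y"
  shows "ennreal a * ennreal x + ennreal b * ennreal y = ennreal (a * x + b * y)"
  using assms by (simp add: ennreal_mult)

lemma hardy_closure_measurable: "F \<in> hardy_closure \<Longrightarrow> slice_measurable F"
  by (simp add: hardy_closure_def)

lemma hardy_closure_approx:
  assumes "F \<in> hardy_closure" "e > 0"
  obtains H where "decaying H" "hardy_norm_sq (\<lambda>w. F w - H w) \<le> ennreal e"
  using assms unfolding hardy_closure_def by blast

lemma hardy_closure_decaying: "decaying H \<Longrightarrow> H \<in> hardy_closure"
  unfolding hardy_closure_def by (auto simp: slice_measurable_decaying intro!: exI[of _ H])

lemma hardy_closure_add:
  assumes "F \<in> hardy_closure" "G \<in> hardy_closure"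
  shows "(\<lambda>w. F w + G w) \<in> hardy_closure"
proof -
  note m = hardy_closure_measurable[OF assms(1)] hardy_closure_measurable[OF assms(2)]
  have "\<exists>H. decaying H \<and> hardy_norm_sq (\<lambda>w. F w + G w - H w) \<le> ennreal e" if "e > 0" for e
  proof -
    obtain H K where H: "decaying H" "hardy_norm_sq (\<lambda>w. F w - H w) \<le> ennreal (e / 4)"
      and K: "decaying K" "hardy_norm_sq (\<lambda>w. G w - K w) \<le> ennreal (e / 4)"
      using hardy_closure_approx[OF assms(1), of "e / 4"] hardy_closure_approx[OF assms(2), of "e / 4"] \<open>e > 0\<close>
      by (metis zero_less_divide_iff zero_less_numeral)
    have "hardy_norm_sq (\<lambda>w. (F w - H w) + (G w - K w)) \<le>
      ennreal (1 + 1) * hardy_norm_sq (\<lambda>w. F w - H w) + ennreal (1 + 1 / 1) * hardy_norm_sq (\<lambda>w. G w - K w)"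
      by (intro hardy_norm_sq_add_le slice_measurable_diff m slice_measurable_decaying H K) auto
    also have "\<dots> \<le> ennreal (1 + 1) * ennreal (e / 4) + ennreal (1 + 1 / 1) * ennreal (e / 4)"
      by (intro add_mono mult_left_mono H K) auto
    also have "\<dots> = ennreal e"
      using \<open>e > 0\<close> by (subst ennreal_linear_combination) auto
    finally have "hardy_norm_sq (\<lambda>w. F w + G w - (H w + K w)) \<le> ennreal e"
      by (simp add: algebra_simps)
    then show ?thesis using decaying_add[OF H(1) K(1)] by blast
  qed
  then show ?thesis
    using slice_measurable_add[OF m] by (simp add: hardy_closure_def)
qed

lemma hardy_closure_cmult:
  assumes "F \<in> hardy_closure"
  shows "(\<lambda>w. c * F w) \<in> hardy_closure"
proof -
  note m = hardy_closure_measurable[OF assms(1)]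
  have "\<exists>H. decaying H \<and> hardy_norm_sq (\<lambda>w. c * F w - H w) \<le> ennreal e" if "e > 0" for e
  proof -
    have "(cmod c)\<^sup>2 + 1 > 0" by (intro add_nonneg_pos) auto
    then have "e / ((cmod c)\<^sup>2 + 1) > 0" using that by simp
    then obtain H where H: "decaying H" "hardy_norm_sq (\<lambda>w. F w - H w) \<le> ennreal (e / ((cmod c)\<^sup>2 + 1))"
      by (rule hardy_closure_approx[OF assms])
    have "hardy_norm_sq (\<lambda>w. c * (F w - H w)) \<le> ennreal ((cmod c)\<^sup>2) * hardy_norm_sq (\<lambda>w. F w - H w)"
      by (intro hardy_norm_sq_cmult_le slice_measurable_diff m slice_measurable_decaying H)
    also have "\<dots> \<le> ennreal ((cmod c)\<^sup>2) * ennreal (e / ((cmod c)\<^sup>2 + 1))"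
      by (intro mult_left_mono H) auto
    also have "\<dots> = ennreal ((cmod c)\<^sup>2 * (e / ((cmod c)\<^sup>2 + 1)))"
      using \<open>e > 0\<close> by (intro ennreal_mult[symmetric]) auto
    also have "\<dots> \<le> ennreal e"
      using \<open>e > 0\<close> \<open>(cmod c)\<^sup>2 + 1 > 0\<close> by (intro ennreal_leI) (simp add: field_simps)
    finally have "hardy_norm_sq (\<lambda>w. c * F w - c * H w) \<le> ennreal e"
      by (simp add: algebra_simps)
    then show ?thesis using decaying_cmult[OF H(1)] by blast
  qed
  then show ?thesis
    using slice_measurable_cmult[OF m] by (simp add: hardy_closure_def)
qed

lemma hardy_closure_diff:
  "F \<in> hardy_closure \<Longrightarrow> G \<in> hardy_closure \<Longrightarrow> (\<lambda>w. F w - G w) \<in> hardy_closure"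
  using hardy_closure_add[OF _ hardy_closure_cmult[of G "-1"]] by simp

lemma hardy_closure_zero: "(\<lambda>w. 0) \<in> hardy_closure"
proof -
  have "decaying (\<lambda>w :: complex ^ 'a. 0)"
    unfolding decaying_def decaying_on_def by (intro exI[of _ 1] exI[of _ 0] conjI) auto
  then show ?thesis by (rule hardy_closure_decaying)
qed

lemma hardy_closure_sum:
  "finite A \<Longrightarrow> (\<And>i. i \<in> A \<Longrightarrow> F i \<in> hardy_closure) \<Longrightarrow> (\<lambda>w. \<Sum>i\<in>A. F i w) \<in> hardy_closure"
  by (induction A rule: finite_induct) (auto intro: hardy_closure_zero hardy_closure_add)

section \<open>Existence of boundary limits and the norm identity\<close>

lemma l2_sq_diff_boundary_le:
  assumes "is_boundary_limit F f" "slice_measurable F" "is_boundary_limit G g" "slice_measurable G"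
  shows "l2_sq (\<lambda>x. f x - g x) \<le> hardy_norm_sq (\<lambda>w. F w - G w)"
  by (rule l2_sq_boundary_le[OF is_boundary_limit_diff[OF assms] slice_measurable_diff[OF assms(2,4)]])

text \<open>Approximants with errors \<open>(1/8) ^ j\<close> have Cauchy boundary values, since
  distances of boundary values are bounded by distances in the Hardy norm. Their limit g is reached
  by the slices of F by way of the approximants.\<close>

lemma boundary_limit_exists:
  fixes F :: "complex ^ 'n \<Rightarrow> complex"
  assumes F: "F \<in> hardy_closure"
  shows "\<exists>f. is_boundary_limit F f"
proof -
  note m = hardy_closure_measurable[OF F]
  have "\<exists>H. decaying H \<and> hardy_norm_sq (\<lambda>w. F w - H w) \<le> ennreal ((1/8) ^ j)" for j
    by (rule hardy_closure_approx[OF F, of "(1/8) ^ j"]) auto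
  then obtain H where H: "\<And>j. decaying (H j)"
    "\<And>j. hardy_norm_sq (\<lambda>w. F w - H j w) \<le> ennreal ((1/8) ^ j)" by metis
  define h where "h j x = H j (cpoint x 0)" for j x
  have hb: "is_boundary_limit (H j) (h j)" for j
    unfolding h_def[abs_def] by (rule decaying_boundary[OF H(1)])
  have hm [measurable]: "h j \<in> borel_measurable borel" for j
    using hb[of j] by (simp add: is_boundary_limit_iff)
  note Hm = slice_measurable_decaying[OF H(1)]
  have cauchy: "l2_sq (\<lambda>x. h k x - h j x) \<le> ennreal (4 * (1/8) ^ j)" if "j \<le> k" for j k
  proof -
    have "l2_sq (\<lambda>x. h k x - h j x) \<le> hardy_norm_sq (\<lambda>w. (H k w - F w) + (F w - H j w))"
      using l2_sq_diff_boundary_le[OF hb[of k] Hm hb[of j] Hm] by simp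
    also have "\<dots> \<le> ennreal (1 + 1) * hardy_norm_sq (\<lambda>w. H k w - F w) +
        ennreal (1 + 1 / 1) * hardy_norm_sq (\<lambda>w. F w - H j w)"
      by (intro hardy_norm_sq_add_le slice_measurable_diff m Hm) auto
    also have "\<dots> \<le> ennreal (1 + 1) * ennreal ((1/8) ^ k) + ennreal (1 + 1 / 1) * ennreal ((1/8) ^ j)"
      using H(2)[of k] H(2)[of j] unfolding hardy_norm_sq_minus_commute[of F "H k"]
      by (intro add_mono mult_left_mono) auto
    also have "\<dots> = ennreal (2 * (1/8) ^ k + 2 * (1/8) ^ j)"
      by (subst ennreal_linear_combination) auto
    also have "\<dots> \<le> ennreal (4 * (1/8) ^ j)"
      using power_decreasing[OF that, of "1/8 :: real"] by (intro ennreal_leI) simp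
    finally show ?thesis .
  qed
  obtain g where gm [measurable]: "g \<in> borel_measurable borel"
    and g: "\<And>j. l2_sq (\<lambda>x. g x - h j x) \<le> ennreal (4 * (1/8) ^ j)"
    using l2_complete[of h 4, OF hm _ cauchy] by auto
  have "l2_sq (\<lambda>x. (g x - h 0 x) + h 0 x) \<le>
      ennreal (1 + 1) * l2_sq (\<lambda>x. g x - h 0 x) + ennreal (1 + 1 / 1) * l2_sq (h 0)"
    by (intro l2_sq_add_le) auto
  also have "\<dots> < top"
    using hb[of 0] le_less_trans[OF g[of 0] ennreal_less_top]
    by (auto simp: is_boundary_limit_iff ennreal_mult_less_top)
  finally have fin: "l2_sq g < top" by simp
  \<comment> \<open>Each use of the squared triangle inequality doubles: 2 times the distance from F
    to \<open>H j\<close>, and 4 times each of the other two. The last of these is at most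
    \<open>4 * (1/8) ^ j\<close>, and 2 + 4 * 4 = 18.\<close>
  have bound: "l2_sq (\<lambda>x. F (cpoint x y) - g x) \<le>
      ennreal (18 * (1/8) ^ j) + ennreal 4 * l2_sq (\<lambda>x. H j (cpoint x y) - h j x)"
    if y: "y \<in> first_octant" for y j
  proof -
    note [measurable] = slice_measurableD[OF m y] slice_measurableD[OF Hm y]
    have "l2_sq (\<lambda>x. (F (cpoint x y) - H j (cpoint x y)) + ((H j (cpoint x y) - h j x) + (h j x - g x))) \<le>
      ennreal (1 + 1) * l2_sq (\<lambda>x. F (cpoint x y) - H j (cpoint x y)) +
      ennreal (1 + 1 / 1) * l2_sq (\<lambda>x. (H j (cpoint x y) - h j x) + (h j x - g x))"
      by (intro l2_sq_add_le) auto
    also have "\<dots> \<le> ennreal 2 * ennreal ((1/8) ^ j) +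
      ennreal 2 * (ennreal (1 + 1) * l2_sq (\<lambda>x. H j (cpoint x y) - h j x) + ennreal (1 + 1 / 1) * l2_sq (\<lambda>x. h j x - g x))"
      using order_trans[OF l2_sq_le_hardy_norm_sq[OF y, of "\<lambda>w. F w - H j w"] H(2)]
      by (intro add_mono mult_mono l2_sq_add_le) auto
    also have "\<dots> \<le> ennreal 2 * ennreal ((1/8) ^ j) +
      ennreal 2 * (ennreal (1 + 1) * l2_sq (\<lambda>x. H j (cpoint x y) - h j x) + ennreal (1 + 1 / 1) * ennreal (4 * (1/8) ^ j))"
      using g[of j] unfolding l2_sq_minus_commute[of g]
      by (intro add_mono mult_left_mono order_refl) auto
    also have "\<dots> = ennreal (18 * (1/8) ^ j) + ennreal 4 * l2_sq (\<lambda>x. H j (cpoint x y) - h j x)"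
    proof -
      have 1: "ennreal (18 * (1/8) ^ j) = ennreal 2 * ennreal ((1/8) ^ j) + ennreal 2 * (ennreal 2 * ennreal (4 * (1/8) ^ j))"
        by (subst ennreal_mult[symmetric], simp, simp, subst ennreal_linear_combination) auto
      have 2: "ennreal 4 = ennreal 2 * ennreal 2" by (simp flip: ennreal_mult)
      show ?thesis unfolding 1 2 by (simp add: distrib_left mult.assoc add_ac)
    qed
    finally show ?thesis by simp
  qed
  have "((\<lambda>y. l2_sq (\<lambda>x. F (cpoint x y) - g x)) \<longlongrightarrow> 0) (at 0 within first_octant)"
  proof (rule order_tendstoI)
    fix a :: ennreal assume "0 < a"
    then obtain e where e: "e > 0" "ennreal e < a"
      by (metis ennreal_less_zero_iff dense ennreal_cases top.not_eq_extremum less_le_trans ennreal_less_top order_less_imp_le order.strict_trans)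
    \<comment> \<open>First j is fixed so that the error uniform in y falls below e; only then does
      y tend to 0.\<close>
    have "(\<lambda>j. 18 * (1/8) ^ j) \<longlonglongrightarrow> (18 * 0 :: real)"
      by (intro tendsto_mult tendsto_const LIMSEQ_power_zero) auto
    then have "\<forall>\<^sub>F j in sequentially. 18 * (1/8 :: real) ^ j < e"
      using e(1) by (intro order_tendstoD) auto
    then obtain j where j: "18 * (1/8 :: real) ^ j < e" by (auto simp: eventually_sequentially)
    have "((\<lambda>y. ennreal (18 * (1/8) ^ j) + ennreal 4 * l2_sq (\<lambda>x. H j (cpoint x y) - h j x))
        \<longlongrightarrow> ennreal (18 * (1/8) ^ j) + ennreal 4 * 0) (at 0 within first_octant)"
      using hb[of j] unfolding is_boundary_limit_iff
      by (intro tendsto_add tendsto_const ennreal_tendsto_cmult) auto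
    moreover have "ennreal (18 * (1/8) ^ j) + ennreal 4 * 0 < a"
      using less_trans[OF ennreal_lessI[OF e(1) j] e(2)] by simp
    ultimately have "\<forall>\<^sub>F y in at 0 within first_octant.
        ennreal (18 * (1/8) ^ j) + ennreal 4 * l2_sq (\<lambda>x. H j (cpoint x y) - h j x) < a"
      by (rule order_tendstoD)
    then show "\<forall>\<^sub>F y in at 0 within first_octant. l2_sq (\<lambda>x. F (cpoint x y) - g x) < a"
      using eventually_in_first_octant by eventually_elim (rule le_less_trans[OF bound])
  qed auto
  then have "is_boundary_limit F g" using gm fin by (simp add: is_boundary_limit_iff)
  then show ?thesis by (intro exI[of _ g])
qed

text \<open>For the hard inequality F is compared with an approximant H on the tube, at the price
  \<open>1 + e'\<close>, the contraction takes H to its boundary values, and these are compared with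
  f at the price \<open>1 + e\<close>. The distance from F to H controls the errors in both
  places.\<close>

lemma hardy_norm_sq_boundary:
  assumes F: "F \<in> hardy_closure" and f: "is_boundary_limit F f"
  shows "hardy_norm_sq F = l2_sq f"
proof (rule antisym)
  note m = hardy_closure_measurable[OF F]
  note fm [measurable] = f[unfolded is_boundary_limit_iff, THEN conjunct1]
  show "hardy_norm_sq F \<le> l2_sq f"
  proof (rule ennreal_le_of_le_mult, rule ennreal_le_of_le_mult)
    fix e e' :: real assume e: "e > 0" "e' > 0"
    \<comment> \<open>The total weight with which the approximation error enters, so that an error
      of \<open>\<epsilon> / K\<close> contributes exactly \<epsilon>.\<close>
    define K where "K = (1 + e') * (1 + 1 / e) + (1 + 1 / e')"
    have K: "K > 0" using e unfolding K_def by (intro add_pos_pos mult_pos_pos) auto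
    show "hardy_norm_sq F \<le> ennreal (1 + e') * (ennreal (1 + e) * l2_sq f)"
    proof (rule ennreal_le_epsilon)
      fix \<epsilon> :: real assume "\<epsilon> > 0"
      then have "\<epsilon> / K > 0" using K by simp
      then obtain H where H: "decaying H" "hardy_norm_sq (\<lambda>w. F w - H w) \<le> ennreal (\<epsilon> / K)"
        by (rule hardy_closure_approx[OF F])
      note Hm = slice_measurable_decaying[OF H(1)]
      note hb = decaying_boundary[OF H(1)]
      note [measurable] = hb[unfolded is_boundary_limit_iff, THEN conjunct1]
      have "l2_sq (\<lambda>x. H (cpoint x 0) - f x) \<le> ennreal (\<epsilon> / K)"
        using l2_sq_diff_boundary_le[OF f m hb Hm] H(2)
        unfolding l2_sq_minus_commute[of f] by (rule order_trans)
      moreover have "l2_sq (\<lambda>x. f x + (H (cpoint x 0) - f x)) \<le>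
          ennreal (1 + e) * l2_sq f + ennreal (1 + 1 / e) * l2_sq (\<lambda>x. H (cpoint x 0) - f x)"
        by (intro l2_sq_add_le e) auto
      ultimately have h: "l2_sq (\<lambda>x. H (cpoint x 0)) \<le>
          ennreal (1 + e) * l2_sq f + ennreal (1 + 1 / e) * ennreal (\<epsilon> / K)"
        by (auto elim!: order_trans intro!: add_left_mono mult_left_mono)
      have "hardy_norm_sq (\<lambda>w. H w + (F w - H w)) \<le>
          ennreal (1 + e') * hardy_norm_sq H + ennreal (1 + 1 / e') * hardy_norm_sq (\<lambda>w. F w - H w)"
        by (intro hardy_norm_sq_add_le slice_measurable_diff m Hm e)
      also have "\<dots> \<le> ennreal (1 + e') * (ennreal (1 + e) * l2_sq f + ennreal (1 + 1 / e) * ennreal (\<epsilon> / K)) +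
          ennreal (1 + 1 / e') * ennreal (\<epsilon> / K)"
        using order_trans[OF decaying_hardy_norm_sq_le[OF H(1), folded l2_sq_def] h] H(2)
        by (intro add_mono mult_left_mono) auto
      also have "\<dots> = ennreal (1 + e') * (ennreal (1 + e) * l2_sq f) + ennreal ((1 + e') * ((1 + 1 / e) * (\<epsilon> / K)) + (1 + 1 / e') * (\<epsilon> / K))"
        using e K \<open>\<epsilon> > 0\<close> by (simp add: distrib_left add.assoc flip: ennreal_mult ennreal_plus)
      also have "(1 + e') * ((1 + 1 / e) * (\<epsilon> / K)) + (1 + 1 / e') * (\<epsilon> / K) = K * (\<epsilon> / K)"
        unfolding K_def by (simp only: distrib_right mult.assoc)
      also have "K * (\<epsilon> / K) = \<epsilon>" using K by simp
      finally show "hardy_norm_sq F \<le> ennreal (1 + e') * (ennreal (1 + e) * l2_sq f) + ennreal \<epsilon>"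
        by simp
    qed
  qed
qed (rule l2_sq_boundary_le[OF f hardy_closure_measurable[OF F]])

lemma is_boundary_limit_boundary_limit:
  "F \<in> hardy_closure \<Longrightarrow> is_boundary_limit F (boundary_limit F)"
  unfolding boundary_limit_def by (rule someI_ex[OF boundary_limit_exists])

lemma hardy_norm_sq_finite: "F \<in> hardy_closure \<Longrightarrow> hardy_norm_sq F < top"
  using hardy_norm_sq_boundary is_boundary_limit_boundary_limit is_boundary_limit_iff by metis

section \<open>The inner product on the closed span\<close>

lemma borel_measurable_cnj [measurable (raw)]:
  "f \<in> borel_measurable M \<Longrightarrow> (\<lambda>x. cnj (f x)) \<in> borel_measurable M"
  by (rule measurable_compose[OF _ borel_measurable_continuous_onI[OF continuous_on_cnj[OF continuous_on_id]]])

lemma integrable_boundary_product: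
  assumes f: "f \<in> borel_measurable borel" "l2_sq f < top" and g: "g \<in> borel_measurable borel" "l2_sq g < top"
  shows "integrable lborel (\<lambda>x. f x * cnj (g x))"
proof -
  note [measurable] = f(1) g(1)
  have sq: "integrable lborel (\<lambda>x. (cmod (u x))\<^sup>2)" if "u \<in> borel_measurable borel" "l2_sq u < top" for u
    using that unfolding l2_sq_def by (intro integrableI_nonneg) auto
  show ?thesis
  proof (rule Bochner_Integration.integrable_bound)
    show "integrable lborel (\<lambda>x. (cmod (f x))\<^sup>2 + (cmod (g x))\<^sup>2)"
      by (intro Bochner_Integration.integrable_add sq f g)
    show "AE x in lborel. norm (f x * cnj (g x)) \<le> norm ((cmod (f x))\<^sup>2 + (cmod (g x))\<^sup>2)"
    proof (intro AE_I2)
      fix x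
      have "2 * (cmod (f x) * cmod (g x)) \<le> (cmod (f x))\<^sup>2 + (cmod (g x))\<^sup>2"
        using sum_squares_bound[of "cmod (f x)" "cmod (g x)"] by simp
      moreover have "0 \<le> cmod (f x) * cmod (g x)" by simp
      ultimately have "cmod (f x) * cmod (g x) \<le> (cmod (f x))\<^sup>2 + (cmod (g x))\<^sup>2" by linarith
      then show "norm (f x * cnj (g x)) \<le> norm ((cmod (f x))\<^sup>2 + (cmod (g x))\<^sup>2)"
        by (simp add: norm_mult)
    qed
  qed measurable
qed

text \<open>This makes the choice in \<open>boundary_limit\<close> harmless: sums and multiples can
  be computed with convenient representatives.\<close>

lemma hardy_inner_eq:
  assumes F: "F \<in> hardy_closure" "is_boundary_limit F f" and G: "G \<in> hardy_closure" "is_boundary_limit G g"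
  shows "hardy_inner F G = (LINT x|lborel. f x * cnj (g x))"
  unfolding hardy_inner_def
proof (rule integral_cong_AE)
  note b = is_boundary_limit_boundary_limit[OF F(1)] is_boundary_limit_boundary_limit[OF G(1)]
  note [measurable] = b[unfolded is_boundary_limit_iff, THEN conjunct1]
    F(2)[unfolded is_boundary_limit_iff, THEN conjunct1] G(2)[unfolded is_boundary_limit_iff, THEN conjunct1]
  show "(\<lambda>x. boundary_limit F x * cnj (boundary_limit G x)) \<in> borel_measurable lborel"
    "(\<lambda>x. f x * cnj (g x)) \<in> borel_measurable lborel" by measurable
  show "AE x in lborel. boundary_limit F x * cnj (boundary_limit G x) = f x * cnj (g x)"
    using is_boundary_limit_unique[OF b(1) F(2) hardy_closure_measurable[OF F(1)]]
      is_boundary_limit_unique[OF b(2) G(2) hardy_closure_measurable[OF G(1)]]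
    by eventually_elim simp
qed

lemma hardy_inner_add_left:
  assumes "F \<in> hardy_closure" "G \<in> hardy_closure" "H \<in> hardy_closure"
  shows "hardy_inner (\<lambda>w. F w + G w) H = hardy_inner F H + hardy_inner G H"
proof -
  note b = assms[THEN is_boundary_limit_boundary_limit]
  note m = assms[THEN hardy_closure_measurable]
  have "integrable lborel (\<lambda>x. boundary_limit F x * cnj (boundary_limit H x))"
    "integrable lborel (\<lambda>x. boundary_limit G x * cnj (boundary_limit H x))"
    using b by (auto simp: is_boundary_limit_iff intro!: integrable_boundary_product)
  then show ?thesis
    unfolding hardy_inner_eq[OF hardy_closure_add[OF assms(1,2)] is_boundary_limit_add[OF b(1) m(1) b(2) m(2)] assms(3) b(3)]
    by (simp add: hardy_inner_def distrib_right)
qed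

lemma hardy_inner_cmult_left:
  assumes "F \<in> hardy_closure" "H \<in> hardy_closure"
  shows "hardy_inner (\<lambda>w. c * F w) H = c * hardy_inner F H"
proof -
  note b = assms[THEN is_boundary_limit_boundary_limit]
  note m = assms[THEN hardy_closure_measurable]
  show ?thesis
    unfolding hardy_inner_eq[OF hardy_closure_cmult[OF assms(1)] is_boundary_limit_cmult[OF b(1) m(1)] assms(2) b(2)]
    by (simp add: hardy_inner_def mult.assoc)
qed

lemma hardy_inner_commute: "hardy_inner F G = cnj (hardy_inner G F)"
  unfolding hardy_inner_def Bochner_Integration.integral_cnj[symmetric] by (simp add: mult.commute)

text \<open>Here the supremum over the tube meets the boundary integral, through
  \<open>hardy_norm_sq_boundary\<close>.\<close>

lemma hardy_inner_self:
  assumes "F \<in> hardy_closure"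
  shows "hardy_inner F F = of_real ((hardy_norm F)\<^sup>2)"
proof -
  let ?f = "boundary_limit F"
  note b = is_boundary_limit_boundary_limit[OF assms]
  note [measurable] = b[unfolded is_boundary_limit_iff, THEN conjunct1]
  have fin: "l2_sq ?f < top" using b by (simp add: is_boundary_limit_iff)
  have "(LINT x|lborel. (cmod (?f x))\<^sup>2) = enn2real (l2_sq ?f)"
    unfolding l2_sq_def by (intro integral_eq_nn_integral) auto
  also have "\<dots> = (hardy_norm F)\<^sup>2"
    unfolding hardy_norm_def hardy_norm_sq_boundary[OF assms b] by simp
  finally have "complex_of_real (LINT x|lborel. (cmod (?f x))\<^sup>2) = of_real ((hardy_norm F)\<^sup>2)" by simp
  then show ?thesis
    unfolding hardy_inner_def complex_norm_square[symmetric] by (simp flip: of_real_power)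
qed

lemma hardy_norm_nonneg: "0 \<le> hardy_norm F"
  by (simp add: hardy_norm_def)

text \<open>The chosen boundary limit of the zero function is known to vanish only almost
  everywhere.\<close>

lemma hardy_inner_zero_left [simp]: "hardy_inner (\<lambda>w. 0) G = 0"
proof -
  have "is_boundary_limit (\<lambda>w. 0) (boundary_limit (\<lambda>w :: complex ^ 'a. 0))"
    by (rule is_boundary_limit_boundary_limit[OF hardy_closure_zero])
  then have "AE x in lborel. boundary_limit (\<lambda>w :: complex ^ 'a. 0) x = 0"
    by (rule is_boundary_limit_unique) (auto simp: is_boundary_limit_iff slice_measurable_def l2_sq_def)
  then have "AE x in lborel. boundary_limit (\<lambda>w :: complex ^ 'a. 0) x * cnj (boundary_limit G x) = 0"
    by eventually_elim simp
  then show ?thesis unfolding hardy_inner_def by (rule integral_eq_zero_AE)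
qed

lemma hardy_inner_zero_right [simp]: "hardy_inner G (\<lambda>w. 0) = 0"
  using hardy_inner_commute[of G "\<lambda>w. 0"] by simp

lemma hardy_inner_cmult_right:
  assumes "F \<in> hardy_closure" "H \<in> hardy_closure"
  shows "hardy_inner H (\<lambda>w. c * F w) = cnj c * hardy_inner H F"
  unfolding hardy_inner_commute[of H] hardy_inner_cmult_left[OF assms] by simp

lemma hardy_inner_diff_left:
  assumes "F \<in> hardy_closure" "G \<in> hardy_closure" "H \<in> hardy_closure"
  shows "hardy_inner (\<lambda>w. F w - G w) H = hardy_inner F H - hardy_inner G H"
  using hardy_inner_add_left[OF assms(1) hardy_closure_cmult[OF assms(2), of "-1"] assms(3)]
    hardy_inner_cmult_left[OF assms(2,3), of "-1"] by simp

lemma hardy_inner_diff_right: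
  assumes "F \<in> hardy_closure" "G \<in> hardy_closure" "H \<in> hardy_closure"
  shows "hardy_inner H (\<lambda>w. F w - G w) = hardy_inner H F - hardy_inner H G"
  unfolding hardy_inner_commute[of H] hardy_inner_diff_left[OF assms] by simp

lemma hardy_inner_sum_left:
  assumes "finite A" "\<And>i. i \<in> A \<Longrightarrow> F i \<in> hardy_closure" "H \<in> hardy_closure"
  shows "hardy_inner (\<lambda>w. \<Sum>i\<in>A. F i w) H = (\<Sum>i\<in>A. hardy_inner (F i) H)"
  using assms(1,2)
proof (induction A rule: finite_induct)
  case (insert i A)
  then show ?case
    using hardy_inner_add_left[of "F i" "\<lambda>w. \<Sum>i\<in>A. F i w" H] hardy_closure_sum[of A F] assms(3)
    by simp
qed simp

lemma hardy_inner_sum_right: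
  assumes "finite A" "\<And>i. i \<in> A \<Longrightarrow> F i \<in> hardy_closure" "H \<in> hardy_closure"
  shows "hardy_inner H (\<lambda>w. \<Sum>i\<in>A. F i w) = (\<Sum>i\<in>A. hardy_inner H (F i))"
proof -
  have "hardy_inner H (\<lambda>w. \<Sum>i\<in>A. F i w) = cnj (hardy_inner (\<lambda>w. \<Sum>i\<in>A. F i w) H)"
    by (rule hardy_inner_commute)
  also have "hardy_inner (\<lambda>w. \<Sum>i\<in>A. F i w) H = (\<Sum>i\<in>A. hardy_inner (F i) H)"
    using assms by (rule hardy_inner_sum_left)
  finally show ?thesis by (simp add: hardy_inner_commute[of H])
qed

lemma hardy_Cauchy_Schwarz:
  assumes F: "F \<in> hardy_closure" and G: "G \<in> hardy_closure"
  shows "cmod (hardy_inner F G) \<le> hardy_norm F * hardy_norm G"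
proof -
  define a b c where "a = (hardy_norm F)\<^sup>2" and "b = (hardy_norm G)\<^sup>2" and "c = hardy_inner F G"
  have quad: "0 \<le> a - 2 * r * (cmod c)\<^sup>2 + r\<^sup>2 * (cmod c)\<^sup>2 * b" for r :: real
  proof -
    define l where "l = of_real r * c"
    have lG: "(\<lambda>w. l * G w) \<in> hardy_closure" by (rule hardy_closure_cmult[OF G])
    have D: "(\<lambda>w. F w - l * G w) \<in> hardy_closure" by (rule hardy_closure_diff[OF F lG])
    have "hardy_inner G F = cnj c" unfolding c_def by (rule hardy_inner_commute)
    then have "hardy_inner (\<lambda>w. F w - l * G w) (\<lambda>w. F w - l * G w) =
        hardy_inner F F - cnj l * c - l * cnj c + l * cnj l * hardy_inner G G"
      unfolding hardy_inner_diff_left[OF F lG D] hardy_inner_diff_right[OF F lG F]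
        hardy_inner_diff_right[OF F lG lG] hardy_inner_cmult_left[OF G F] hardy_inner_cmult_left[OF G lG]
        hardy_inner_cmult_right[OF G F] hardy_inner_cmult_right[OF G G]
      by (simp add: c_def algebra_simps)
    moreover have "c * cnj c = of_real ((cmod c)\<^sup>2)" by (rule complex_norm_square[symmetric])
    then have "cnj l * c = of_real (r * (cmod c)\<^sup>2)" "l * cnj c = of_real (r * (cmod c)\<^sup>2)"
      "l * cnj l = of_real (r\<^sup>2 * (cmod c)\<^sup>2)"
      by (simp_all add: l_def mult_ac power2_eq_square)
    ultimately have "hardy_inner (\<lambda>w. F w - l * G w) (\<lambda>w. F w - l * G w) =
        of_real (a - r * (cmod c)\<^sup>2 - r * (cmod c)\<^sup>2 + r\<^sup>2 * (cmod c)\<^sup>2 * b)"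
      unfolding hardy_inner_self[OF F] hardy_inner_self[OF G] a_def b_def
      by (simp only: of_real_diff of_real_add of_real_mult)
    then have "(hardy_norm (\<lambda>w. F w - l * G w))\<^sup>2 = a - 2 * r * (cmod c)\<^sup>2 + r\<^sup>2 * (cmod c)\<^sup>2 * b"
      unfolding hardy_inner_self[OF D] of_real_eq_iff by simp
    then show ?thesis by (metis zero_le_power2)
  qed
  have "(cmod c)\<^sup>2 \<le> a * b"
  proof (cases "b = 0")
    case True
    show ?thesis
    proof (rule ccontr)
      assume "\<not> ?thesis"
      then have "(cmod c)\<^sup>2 > 0" using True by simp
      \<comment> \<open>For b = 0 the quadratic is linear in r, and this r gives it the value
        -1.\<close>
      then show False using quad[of "(a + 1) / (2 * (cmod c)\<^sup>2)"] True by simp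
    qed
  next
    case False
    then have "b > 0" by (simp add: b_def)
    \<comment> \<open>The minimum of the quadratic is at r = 1 / b.\<close>
    then show ?thesis using quad[of "1 / b"] by (simp add: field_simps power2_eq_square)
  qed
  also have "\<dots> = (hardy_norm F * hardy_norm G)\<^sup>2" by (simp add: a_def b_def power_mult_distrib)
  finally show ?thesis
    unfolding c_def by (rule power2_le_imp_le) (simp add: hardy_norm_nonneg)
qed

section \<open>Orthonormalization\<close>

definition normalized :: "(complex ^ 'n::finite \<Rightarrow> complex) \<Rightarrow> complex ^ 'n \<Rightarrow> complex" where
  "normalized G w = G w / of_real (hardy_norm G)"

lemma normalized_eq: "normalized G = (\<lambda>w. inverse (of_real (hardy_norm G)) * G w)"
  by (simp add: normalized_def fun_eq_iff field_simps)

lemma normalized_hardy_closure: "G \<in> hardy_closure \<Longrightarrow> normalized G \<in> hardy_closure"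
  unfolding normalized_eq by (rule hardy_closure_cmult)

lemma hardy_inner_normalized_right:
  "F \<in> hardy_closure \<Longrightarrow> G \<in> hardy_closure \<Longrightarrow>
    hardy_inner F (normalized G) = hardy_inner F G / of_real (hardy_norm G)"
  unfolding normalized_eq by (subst hardy_inner_cmult_right) (auto simp: divide_inverse)

lemma normalized_cases:
  assumes G: "G \<in> hardy_closure"
  shows "hardy_norm (normalized G) = 1 \<or> normalized G = (\<lambda>w. 0)"
proof (cases "hardy_norm G = 0")
  case False
  have "hardy_inner (normalized G) (normalized G) = 1"
    unfolding hardy_inner_normalized_right[OF normalized_hardy_closure[OF G] G]
      hardy_inner_commute[of "normalized G" G] hardy_inner_normalized_right[OF G G]
    using False by (simp add: hardy_inner_self[OF G] power2_eq_square)
  then have "(hardy_norm (normalized G))\<^sup>2 = 1"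
    unfolding hardy_inner_self[OF normalized_hardy_closure[OF G]] by (simp only: of_real_eq_1_iff)
  then show ?thesis using hardy_norm_nonneg[of "normalized G"] by (simp add: power2_eq_1_iff)
qed (simp add: normalized_def fun_eq_iff)

text \<open>Zero functions are allowed in an orthonormal system: Gram-Schmidt produces them from linearly
  dependent functions, because division by a vanishing norm yields zero.\<close>

definition orthonormal :: "(nat \<Rightarrow> complex ^ 'n::finite \<Rightarrow> complex) \<Rightarrow> nat \<Rightarrow> bool" where
  "orthonormal B k \<longleftrightarrow> (\<forall>j<k. B j \<in> hardy_closure \<and> (hardy_norm (B j) = 1 \<or> B j = (\<lambda>w. 0)) \<and>
     (\<forall>i<j. hardy_inner (B j) (B i) = 0))"

definition residual ::
    "(nat \<Rightarrow> complex ^ 'n::finite \<Rightarrow> complex) \<Rightarrow> nat \<Rightarrow> (complex ^ 'n \<Rightarrow> complex) \<Rightarrow> complex ^ 'n \<Rightarrow> complex" where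
  "residual B k G w = G w - (\<Sum>j<k. hardy_inner G (B j) * B j w)"

lemma orthonormal_hardy_closure: "orthonormal B k \<Longrightarrow> j < k \<Longrightarrow> B j \<in> hardy_closure"
  by (simp add: orthonormal_def)

lemma orthonormal_mono: "orthonormal B k \<Longrightarrow> j \<le> k \<Longrightarrow> orthonormal B j"
  by (auto simp: orthonormal_def)

lemma orthonormal_orthogonal:
  assumes "orthonormal B k" "i < k" "j < k" "i \<noteq> j"
  shows "hardy_inner (B i) (B j) = 0"
proof (cases "j < i")
  case False
  then show ?thesis
    using assms hardy_inner_commute[of "B i" "B j"] by (auto simp: orthonormal_def)
qed (use assms in \<open>auto simp: orthonormal_def\<close>)

text \<open>In this form unit vectors and zero functions need no distinction later.\<close>

lemma orthonormal_self:
  assumes "orthonormal B k" "i < k"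
  shows "hardy_inner G (B i) * hardy_inner (B i) (B i) = hardy_inner G (B i)"
proof -
  have "hardy_norm (B i) = 1 \<or> B i = (\<lambda>w. 0)" using assms by (auto simp: orthonormal_def)
  then show ?thesis
    using hardy_inner_self[OF orthonormal_hardy_closure[OF assms]] by auto
qed

context
  fixes B :: "nat \<Rightarrow> complex ^ 'n::finite \<Rightarrow> complex" and k :: nat
  assumes B: "orthonormal B k"
begin

lemma projection_hardy_closure: "(\<lambda>w. \<Sum>j<k. c j * B j w) \<in> hardy_closure"
  by (intro hardy_closure_sum hardy_closure_cmult orthonormal_hardy_closure[OF B]) auto

lemma residual_hardy_closure: "G \<in> hardy_closure \<Longrightarrow> residual B k G \<in> hardy_closure"
  unfolding residual_def[abs_def] by (intro hardy_closure_diff projection_hardy_closure)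

lemma hardy_inner_projection:
  assumes "H \<in> hardy_closure"
  shows "hardy_inner (\<lambda>w. \<Sum>j<k. c j * B j w) H = (\<Sum>j<k. c j * hardy_inner (B j) H)"
proof -
  have "hardy_inner (\<lambda>w. \<Sum>j<k. c j * B j w) H = (\<Sum>j<k. hardy_inner (\<lambda>w. c j * B j w) H)"
    by (intro hardy_inner_sum_left hardy_closure_cmult orthonormal_hardy_closure[OF B] assms) auto
  also have "\<dots> = (\<Sum>j<k. c j * hardy_inner (B j) H)"
    by (intro sum.cong refl hardy_inner_cmult_left orthonormal_hardy_closure[OF B] assms) auto
  finally show ?thesis .
qed

lemma hardy_inner_residual_left:
  assumes "G \<in> hardy_closure" "H \<in> hardy_closure"
  shows "hardy_inner (residual B k G) H = hardy_inner G H - (\<Sum>j<k. hardy_inner G (B j) * hardy_inner (B j) H)"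
  unfolding residual_def[abs_def]
  by (simp add: hardy_inner_diff_left[OF assms(1) projection_hardy_closure assms(2)] hardy_inner_projection[OF assms(2)])

lemma residual_orthogonal:
  assumes "G \<in> hardy_closure" "i < k"
  shows "hardy_inner (residual B k G) (B i) = 0"
proof -
  have "(\<Sum>j<k. hardy_inner G (B j) * hardy_inner (B j) (B i)) = (\<Sum>j<k. if j = i then hardy_inner G (B i) else 0)"
    using orthonormal_orthogonal[OF B _ assms(2)] orthonormal_self[OF B assms(2)]
    by (intro sum.cong) auto
  then show ?thesis
    using assms hardy_inner_residual_left[OF assms(1) orthonormal_hardy_closure[OF B assms(2)]] by simp
qed

lemma hardy_inner_residual_right:
  assumes "R \<in> hardy_closure" "G \<in> hardy_closure" "\<And>i. i < k \<Longrightarrow> hardy_inner R (B i) = 0"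
  shows "hardy_inner R (residual B k G) = hardy_inner R G"
proof -
  have "hardy_inner (B j) R = 0" if "j < k" for j
    using assms(3)[OF that] hardy_inner_commute[of "B j" R] by simp
  then have "hardy_inner (residual B k G) R = hardy_inner G R"
    using hardy_inner_residual_left[OF assms(2,1)] by simp
  then show ?thesis
    unfolding hardy_inner_commute[of R "residual B k G"] hardy_inner_commute[of R G] by simp
qed

text \<open>Bessel's identity: the residual is orthogonal to the projection, so its pairing with
  itself is its pairing with G.\<close>

lemma residual_norm_sq:
  assumes "G \<in> hardy_closure"
  shows "(hardy_norm (residual B k G))\<^sup>2 = (hardy_norm G)\<^sup>2 - (\<Sum>j<k. (cmod (hardy_inner G (B j)))\<^sup>2)"
proof -
  have "hardy_inner (residual B k G) (residual B k G) = hardy_inner (residual B k G) G"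
    by (intro hardy_inner_residual_right residual_hardy_closure residual_orthogonal assms)
  also have "\<dots> = hardy_inner G G - (\<Sum>j<k. hardy_inner G (B j) * cnj (hardy_inner G (B j)))"
    unfolding hardy_inner_residual_left[OF assms assms] by (simp flip: hardy_inner_commute)
  also have "\<dots> = of_real ((hardy_norm G)\<^sup>2 - (\<Sum>j<k. (cmod (hardy_inner G (B j)))\<^sup>2))"
    by (simp add: hardy_inner_self[OF assms] complex_norm_square flip: of_real_power)
  finally show ?thesis
    unfolding hardy_inner_self[OF residual_hardy_closure[OF assms]] of_real_eq_iff .
qed

lemma residual_norm_le:
  assumes "G \<in> hardy_closure"
  shows "hardy_norm (residual B k G) \<le> hardy_norm G"
proof (rule power2_le_imp_le)
  show "(hardy_norm (residual B k G))\<^sup>2 \<le> (hardy_norm G)\<^sup>2"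
    unfolding residual_norm_sq[OF assms] by (simp add: sum_nonneg)
qed (rule hardy_norm_nonneg)

end

lemma gram_schmidt_eq: "gram_schmidt f k = normalized (residual (gram_schmidt f) k (f k))"
  by (subst gram_schmidt.simps) (simp add: Let_def normalized_def[abs_def] residual_def[abs_def])

lemma orthonormal_Suc_normalized:
  assumes B: "orthonormal B k" and G: "G \<in> hardy_closure" and Bk: "B k = normalized (residual B k G)"
  shows "orthonormal B (Suc k)"
proof -
  note T = residual_hardy_closure[OF B G]
  have orth: "hardy_inner (B k) (B i) = 0" if "i < k" for i
  proof -
    have "hardy_inner (B i) (residual B k G) = 0"
      using residual_orthogonal[OF B G that] hardy_inner_commute[of "B i" "residual B k G"] by simp
    then have "hardy_inner (B i) (B k) = 0"
      unfolding Bk hardy_inner_normalized_right[OF orthonormal_hardy_closure[OF B that] T] by simp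
    then show ?thesis using hardy_inner_commute[of "B k" "B i"] by simp
  qed
  show ?thesis
    unfolding orthonormal_def
  proof (intro allI impI)
    fix j assume "j < Suc k"
    then consider "j < k" | "j = k" by linarith
    then show "B j \<in> hardy_closure \<and> (hardy_norm (B j) = 1 \<or> B j = (\<lambda>w. 0)) \<and>
        (\<forall>i<j. hardy_inner (B j) (B i) = 0)"
    proof cases
      case 1
      then show ?thesis using B unfolding orthonormal_def by blast
    next
      case 2
      then show ?thesis
        using orth normalized_cases[OF T, folded Bk] normalized_hardy_closure[OF T, folded Bk] by blast
    qed
  qed
qed

lemma gram_schmidt_orthonormal:
  assumes "\<And>j. j < k \<Longrightarrow> f j \<in> hardy_closure"
  shows "orthonormal (gram_schmidt f) k"
  using assms
proof (induction k)
  case (Suc k)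
  then show ?case by (intro orthonormal_Suc_normalized[OF _ _ gram_schmidt_eq]) auto
qed (simp add: orthonormal_def)

text \<open>Trial functions run Gram-Schmidt on a list that begins with finished basis functions;
  those are fixed, the zero ones among them included.\<close>

lemma gram_schmidt_of_orthonormal:
  assumes B: "orthonormal B k" and "j < k" and f: "\<And>i. i < k \<Longrightarrow> f i = B i"
  shows "gram_schmidt f j = B j"
  using \<open>j < k\<close>
proof (induction j rule: less_induct)
  case (less j)
  then have IH: "gram_schmidt f i = B i" if "i < j" for i using that by auto
  have "(\<Sum>i<j. hardy_inner (B j) (gram_schmidt f i) * gram_schmidt f i w) = 0" for w
    using less.prems by (intro sum.neutral ballI) (simp add: IH orthonormal_orthogonal[OF B])
  then have "residual (gram_schmidt f) j (f j) = B j"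
    by (simp add: residual_def[abs_def] f[OF less.prems])
  moreover have "normalized (B j) = B j"
    using B less.prems by (auto simp: orthonormal_def normalized_def fun_eq_iff)
  ultimately show ?case by (simp add: gram_schmidt_eq[of f j])
qed

section \<open>The greedy estimate\<close>

lemma kernel_hardy_closure: "z \<in> tube \<Longrightarrow> kernel z \<in> hardy_closure"
  by (rule hardy_closure_decaying[OF decaying_kernel])

lemma slice_measurable_holomorphic:
  assumes "holomorphic_several F tube"
  shows "slice_measurable F"
  unfolding slice_measurable_def
proof (intro ballI borel_measurable_continuous_onI)
  fix y :: "real ^ 'a" assume y: "y \<in> first_octant"
  have "continuous_on tube F"
    using assms unfolding holomorphic_several_def
    by (auto simp: continuous_on_eq_continuous_within intro: has_derivative_continuous)
  moreover have "(\<lambda>x. cpoint x y) ` UNIV \<subseteq> tube" using y by (auto simp: tube_def)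
  ultimately show "continuous_on UNIV (\<lambda>x. F (cpoint x y))"
    by (rule continuous_on_compose2[OF _ continuous_on_cpoint[OF continuous_on_id continuous_on_const]])
qed

text \<open>Besides unfolding the class, this places F in the closed span: the partial sums of its
  series are decaying.\<close>

lemma hardy_classE:
  assumes "F \<in> hardy_class M"
  obtains c w where "F \<in> hardy_closure" "\<And>j. w j \<in> tube" "summable (\<lambda>j. cmod (c j))" "(\<Sum>j. cmod (c j)) \<le> M"
    "(\<lambda>N. hardy_norm (\<lambda>v. F v - (\<Sum>j<N. c j * normalized (kernel (w j)) v))) \<longlonglongrightarrow> 0"
proof -
  from assms obtain c w where F: "F \<in> hardy_space" and w: "\<And>j. w j \<in> tube"
    and lim: "(\<lambda>N. hardy_norm (\<lambda>v. F v - (\<Sum>j<N. c j * normalized (kernel (w j)) v))) \<longlonglongrightarrow> 0"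
    and c: "summable (\<lambda>j. cmod (c j))" "(\<Sum>j. cmod (c j)) \<le> M"
    unfolding hardy_class_def normalized_def by blast
  define S where "S N v = (\<Sum>j<N. c j * normalized (kernel (w j)) v)" for N v
  have dec: "decaying (S N)" for N
  proof (induction N)
    case 0
    have "decaying (\<lambda>v. 0 * kernel (w 0) v)" by (intro decaying_cmult decaying_kernel w)
    then show ?case by (simp add: S_def[abs_def])
  next
    case (Suc N)
    have "decaying (\<lambda>v. S N v + c N * (inverse (of_real (hardy_norm (kernel (w N)))) * kernel (w N) v))"
      by (intro decaying_add decaying_cmult decaying_kernel w Suc)
    then show ?case by (simp add: S_def[abs_def] normalized_eq)
  qed
  have m: "slice_measurable F"
    using F by (intro slice_measurable_holomorphic) (simp add: hardy_space_def)
  have "\<exists>H. decaying H \<and> hardy_norm_sq (\<lambda>w. F w - H w) \<le> ennreal e" if "e > 0" for e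
  proof -
    have "\<forall>\<^sub>F N in sequentially. hardy_norm (\<lambda>v. F v - S N v) < sqrt e"
      using that by (intro order_tendstoD(2)[OF lim[folded S_def]]) auto
    then obtain N where N: "hardy_norm (\<lambda>v. F v - S N v) < sqrt e" by (auto simp: eventually_sequentially)
    \<comment> \<open>A small \<open>hardy_norm\<close> says nothing while the extended norm may be
      infinite, so finiteness comes first; it uses that F belongs to
      \<open>hardy_space\<close>.\<close>
    have "hardy_norm_sq (\<lambda>v. F v + (-1) * S N v) \<le>
        ennreal (1 + 1) * hardy_norm_sq F + ennreal (1 + 1 / 1) * hardy_norm_sq (\<lambda>v. (-1) * S N v)"
      by (intro hardy_norm_sq_add_le m slice_measurable_cmult slice_measurable_decaying dec) auto
    also have "\<dots> < top"
      using F hardy_norm_sq_finite[OF hardy_closure_decaying[OF decaying_cmult[OF dec[of N]], of "-1"]]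
      by (auto simp: hardy_space_def ennreal_mult_less_top)
    finally have "hardy_norm_sq (\<lambda>v. F v - S N v) < top" by simp
    then have "hardy_norm_sq (\<lambda>v. F v - S N v) = ennreal (enn2real (hardy_norm_sq (\<lambda>v. F v - S N v)))"
      by simp
    also have "\<dots> \<le> ennreal e"
      using N by (intro ennreal_leI) (simp add: hardy_norm_def)
    finally show ?thesis using dec by blast
  qed
  then have "F \<in> hardy_closure" using m by (simp add: hardy_closure_def)
  from that[OF this w c lim] show ?thesis .
qed

text \<open>F is a sum of normalized kernels with coefficients of total modulus at most M, so
  pairing with F costs at most M times the worst pairing with one of them; Cauchy-Schwarz removes
  the tail.\<close>

lemma hardy_class_inner_le:
  assumes F: "F \<in> hardy_class M" and R: "R \<in> hardy_closure"
    and s: "\<And>u. u \<in> tube \<Longrightarrow> cmod (hardy_inner R (normalized (kernel u))) \<le> s"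
  shows "cmod (hardy_inner R F) \<le> M * s"
proof -
  obtain c w where V: "F \<in> hardy_closure" and w: "\<And>j. w j \<in> tube"
    and c: "summable (\<lambda>j. cmod (c j))" "(\<Sum>j. cmod (c j)) \<le> M"
    and lim: "(\<lambda>N. hardy_norm (\<lambda>v. F v - (\<Sum>j<N. c j * normalized (kernel (w j)) v))) \<longlonglongrightarrow> 0"
    by (rule hardy_classE[OF F]) blast
  define S where "S N v = (\<Sum>j<N. c j * normalized (kernel (w j)) v)" for N v
  have e: "(\<lambda>v. c j * normalized (kernel (w j)) v) \<in> hardy_closure" for j
    by (intro hardy_closure_cmult normalized_hardy_closure kernel_hardy_closure w)
  have SV: "S N \<in> hardy_closure" for N
    unfolding S_def[abs_def] by (intro hardy_closure_sum e) auto
  have s0: "s \<ge> 0" using s[OF w[of 0]] norm_ge_zero order_trans by blast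
  have SB: "cmod (hardy_inner R (S N)) \<le> M * s" for N
  proof -
    have "hardy_inner R (S N) = (\<Sum>j<N. hardy_inner R (\<lambda>v. c j * normalized (kernel (w j)) v))"
      unfolding S_def[abs_def] by (intro hardy_inner_sum_right e R) auto
    also have "\<dots> = (\<Sum>j<N. cnj (c j) * hardy_inner R (normalized (kernel (w j))))"
      by (intro sum.cong refl hardy_inner_cmult_right normalized_hardy_closure kernel_hardy_closure w R)
    also have "cmod \<dots> \<le> (\<Sum>j<N. cmod (c j) * s)"
      by (intro sum_norm_le) (simp add: norm_mult s w mult_left_mono)
    also have "\<dots> = (\<Sum>j<N. cmod (c j)) * s" by (simp add: sum_distrib_right)
    also have "\<dots> \<le> M * s"
      using sum_le_suminf[OF c(1), of "{..<N}"] c(2) s0 by (intro mult_right_mono) auto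
    finally show ?thesis .
  qed
  have "cmod (hardy_inner R F) \<le> M * s + hardy_norm R * hardy_norm (\<lambda>v. F v - S N v)" for N
  proof -
    have "hardy_inner R F = hardy_inner R (S N) + hardy_inner R (\<lambda>v. F v - S N v)"
      using hardy_inner_diff_right[OF V SV R] by simp
    then have "cmod (hardy_inner R F) \<le> cmod (hardy_inner R (S N)) + cmod (hardy_inner R (\<lambda>v. F v - S N v))"
      by (simp add: norm_triangle_ineq)
    then show ?thesis
      using SB[of N] hardy_Cauchy_Schwarz[OF R hardy_closure_diff[OF V SV[of N]]] by linarith
  qed
  moreover have "(\<lambda>N. M * s + hardy_norm R * hardy_norm (\<lambda>v. F v - S N v)) \<longlonglongrightarrow> M * s + hardy_norm R * 0"
    unfolding S_def by (intro tendsto_intros lim)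
  ultimately have "cmod (hardy_inner R F) \<le> M * s + hardy_norm R * 0"
    by (intro LIMSEQ_le_const) auto
  then show ?thesis by simp
qed

text \<open>The start of the recursion. With F itself in place of R, the preceding estimate bounds
  the squared norm by M times the norm.\<close>

lemma hardy_class_norm_le:
  assumes F: "F \<in> hardy_class M"
  shows "hardy_norm F \<le> M"
proof -
  have V: "F \<in> hardy_closure" by (rule hardy_classE[OF F])
  obtain c where c: "summable (\<lambda>j. cmod (c j))" "(\<Sum>j. cmod (c j :: complex)) \<le> M"
    by (rule hardy_classE[OF F]) blast
  have M: "M \<ge> 0" using suminf_nonneg[OF c(1)] c(2) by simp
  have "cmod (hardy_inner F F) \<le> M * hardy_norm F"
  proof (rule hardy_class_inner_le[OF F V])
    fix u :: "complex ^ 'a" assume "u \<in> tube"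
    note u = kernel_hardy_closure[OF this]
    have "hardy_norm (normalized (kernel u)) \<le> 1"
      using normalized_cases[OF u] by (auto simp: hardy_norm_def)
    then show "cmod (hardy_inner F (normalized (kernel u))) \<le> hardy_norm F"
      using hardy_Cauchy_Schwarz[OF V normalized_hardy_closure[OF u]]
        mult_left_mono[of _ 1 "hardy_norm F"] hardy_norm_nonneg[of F] by fastforce
  qed
  then have "hardy_norm F * hardy_norm F \<le> M * hardy_norm F"
    by (simp add: hardy_inner_self[OF V] power2_eq_square norm_mult hardy_norm_nonneg)
  then show ?thesis
    using M hardy_norm_nonneg[of F] by (cases "hardy_norm F = 0") auto
qed

text \<open>The quantities \<open>b k / M\<^sup>2\<close> satisfy \<open>s (1 - s) \<le> s / (1 + s)\<close>, so their reciprocals grow by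
  at least one in each step.\<close>

lemma greedy_recursion:
  fixes b a :: "nat \<Rightarrow> real"
  assumes "M > 0" "b 0 \<le> M\<^sup>2" and b0: "\<And>k. k \<le> m \<Longrightarrow> 0 \<le> b k"
    and le: "\<And>k. k < m \<Longrightarrow> b k \<le> M * a k" and step: "\<And>k. k < m \<Longrightarrow> b (Suc k) = b k - (a k)\<^sup>2"
  shows "b m \<le> M\<^sup>2 / (real m + 1)"
proof -
  have "k \<le> m \<Longrightarrow> b k \<le> M\<^sup>2 / (real k + 1)" for k
  proof (induction k)
    case (Suc k)
    define s where "s = b k / M\<^sup>2"
    have s: "s \<ge> 0" "s \<le> 1 / (real k + 1)" "b k = M\<^sup>2 * s"
      using Suc b0[of k] \<open>M > 0\<close> by (auto simp: s_def field_simps)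
    have "(M * s)\<^sup>2 \<le> (a k)\<^sup>2"
      using le[of k] Suc.prems \<open>M > 0\<close> s by (intro power_mono) (auto simp: power2_eq_square)
    then have "b (Suc k) \<le> M\<^sup>2 * (s * (1 - s))"
      using step[of k] Suc.prems s(3) by (simp add: power2_eq_square algebra_simps)
    also have "s * (1 - s) \<le> s / (1 + s)"
      using s(1) by (simp add: field_simps power2_eq_square)
    \<comment> \<open>The left side increases with s, and at the largest value 1 / (k + 1) it equals
      1 / (k + 2).\<close>
    also have "s / (1 + s) \<le> 1 / (real (Suc k) + 1)"
      using s(1,2) by (simp add: field_simps)
    finally show ?case using \<open>M > 0\<close> by (simp add: mult_left_mono)
  qed (use assms in auto)
  then show ?thesis by simp
qed

section \<open>Basis functions and trial functions\<close>

lemma multiple_kernel_fresh: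
  assumes "\<And>j. j < k \<Longrightarrow> z j \<noteq> z k"
  shows "multiple_kernel d z k = kernel (z k)"
proof -
  have "{j. j \<le> k \<and> z j = z k} = {k}" using assms by (force simp: le_less)
  then show ?thesis by (simp add: multiple_kernel_def multiplicity_at_def fun_eq_iff)
qed

lemma basis_fun_orthonormal: "\<forall>k<m. z k \<in> tube \<Longrightarrow> orthonormal (basis_fun d z) m"
  unfolding basis_fun_def
  by (intro gram_schmidt_orthonormal hardy_closure_decaying decaying_multiple_kernel) auto

lemma trial_fun_eq:
  assumes "\<forall>k<m. z k \<in> tube" "k < m"
  shows "trial_fun d z k u = normalized (residual (basis_fun d z) k (multiple_kernel d (z(k := u)) k))"
proof -
  have "orthonormal (basis_fun d z) k"
    by (rule orthonormal_mono[OF basis_fun_orthonormal[OF assms(1)]]) (use assms(2) in simp)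
  from gram_schmidt_of_orthonormal[OF this]
  have "gram_schmidt (\<lambda>j. if j < k then basis_fun d z j else multiple_kernel d (z(k := u)) k) j = basis_fun d z j"
    if "j < k" for j using that by auto
  then show ?thesis
    unfolding trial_fun_def gram_schmidt_eq[of _ k] by (simp add: residual_def[abs_def])
qed

lemma basis_fun_eq: "basis_fun d z k = normalized (residual (basis_fun d z) k (multiple_kernel d z k))"
  unfolding basis_fun_def by (rule gram_schmidt_eq)

lemma hardy_inner_null:
  assumes "F \<in> hardy_closure" "G \<in> hardy_closure" "hardy_norm G = 0"
  shows "hardy_inner F G = 0"
  using hardy_Cauchy_Schwarz[OF assms(1,2)] assms(3) by simp

text \<open>At a repeated point the kernel already lies in the span of the earlier basis functions.\<close>

lemma residual_kernel_le_trial: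
  assumes z: "\<forall>k<m. z k \<in> tube" and k: "k < m" and u: "u \<in> tube" and F: "F \<in> hardy_closure"
  shows "cmod (hardy_inner (residual (basis_fun d z) k F) (normalized (kernel u)))
    \<le> cmod (hardy_inner F (trial_fun d z k u))"
proof -
  let ?B = "basis_fun d z"
  define R where "R = residual ?B k F"
  have Bm: "orthonormal ?B m" by (rule basis_fun_orthonormal[OF z])
  have B: "orthonormal ?B k" using Bm k by (auto intro: orthonormal_mono)
  have R: "R \<in> hardy_closure" unfolding R_def by (rule residual_hardy_closure[OF B F])
  have orth: "hardy_inner R (?B i) = 0" if "i < k" for i
    unfolding R_def by (rule residual_orthogonal[OF B F that])
  note K = kernel_hardy_closure[OF u]
  show ?thesis
  proof (cases "\<exists>j<k. z j = u")
    case True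
    \<comment> \<open>At the first occurrence of u the multiple kernel is the kernel itself, with no
      derivative.\<close>
    then obtain j where j: "j < k" "z j = u" "\<And>i. i < j \<Longrightarrow> z i \<noteq> u"
      using exists_least_iff[of "\<lambda>j. j < k \<and> z j = u"] by (metis order.strict_trans)
    have Bj: "orthonormal ?B j" using B j(1) by (auto intro: orthonormal_mono)
    define T where "T = residual ?B j (kernel u)"
    have T: "T \<in> hardy_closure" unfolding T_def by (rule residual_hardy_closure[OF Bj K])
    have "multiple_kernel d z j = kernel u"
      using multiple_kernel_fresh[of j z d] j by simp
    then have "?B j = normalized T" using basis_fun_eq[of d z j] by (simp add: T_def)
    then have "hardy_inner R T / of_real (hardy_norm T) = 0"
      using orth[OF j(1)] hardy_inner_normalized_right[OF R T] by simp
    \<comment> \<open>If T has norm zero the quotient is 0 by convention and carries no information;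
      Cauchy-Schwarz covers that case.\<close>
    then have "hardy_inner R T = 0" using hardy_inner_null[OF R T] by auto
    moreover have "hardy_inner R T = hardy_inner R (kernel u)"
      unfolding T_def using j(1) by (intro hardy_inner_residual_right[OF Bj R K] orth) auto
    ultimately show ?thesis
      by (simp add: R_def[symmetric] hardy_inner_normalized_right[OF R K])
  next
    case False
    then have mk: "multiple_kernel d (z(k := u)) k = kernel u"
      using multiple_kernel_fresh[of k "z(k := u)" d] by auto
    define T where "T = residual ?B k (kernel u)"
    have T: "T \<in> hardy_closure" unfolding T_def by (rule residual_hardy_closure[OF B K])
    have RT: "hardy_inner R T = hardy_inner R (kernel u)"
      unfolding T_def by (rule hardy_inner_residual_right[OF B R K orth])
    have "hardy_inner (?B i) T = 0" if "i < k" for i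
      using residual_orthogonal[OF B K that] hardy_inner_commute[of "?B i" T] by (simp add: T_def)
    \<comment> \<open>T is orthogonal to the projection that distinguishes R from F.\<close>
    then have "hardy_inner R T = hardy_inner F T"
      unfolding R_def hardy_inner_residual_left[OF B F T] by simp
    then have eq: "hardy_inner F (trial_fun d z k u) = hardy_inner R (kernel u) / of_real (hardy_norm T)"
      using trial_fun_eq[OF z k, of d u] hardy_inner_normalized_right[OF F T] RT
      by (simp add: mk T_def)
    have le: "hardy_norm T \<le> hardy_norm (kernel u)"
      unfolding T_def by (rule residual_norm_le[OF B K])
    show ?thesis
    proof (cases "hardy_norm T = 0")
      case True
      then have "hardy_inner R (kernel u) = 0" using hardy_inner_null[OF R T] RT by simp
      then show ?thesis by (simp add: R_def[symmetric] hardy_inner_normalized_right[OF R K])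
    next
      case False
      then have "hardy_norm T > 0" using hardy_norm_nonneg[of T] by simp
      \<comment> \<open>Projection has shortened the kernel, so normalizing T enlarges the pairing
        at least as much as normalizing the kernel does.\<close>
      then have "cmod (hardy_inner R (kernel u)) / hardy_norm (kernel u) \<le> cmod (hardy_inner R (kernel u)) / hardy_norm T"
        using le by (intro divide_left_mono mult_pos_pos) auto
      then show ?thesis
        unfolding eq R_def[symmetric] hardy_inner_normalized_right[OF R K]
        by (simp add: norm_divide hardy_norm_nonneg)
    qed
  qed
qed

theorem theorem5p1:
  fixes M :: real and F :: "complex ^ 'n \<Rightarrow> complex" and d :: "complex ^ 'n"
    and z :: "nat \<Rightarrow> complex ^ 'n" and m :: nat
  assumes "M > 0"
    and "(\<Sum>j\<in>UNIV. (cmod (d $ j))\<^sup>2) = 1"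
    and "F \<in> hardy_class M"
    and "\<forall>k<m. z k \<in> tube"
    and "maximal_selection d z F m"
  shows "hardy_norm (\<lambda>w. F w - partial_sum d z F m w) \<le> M / sqrt (real m + 1)"
proof -
  let ?B = "basis_fun d z"
  have V: "F \<in> hardy_closure" by (rule hardy_classE[OF assms(3)])
  have B: "orthonormal ?B k" if "k \<le> m" for k
    using basis_fun_orthonormal[OF assms(4)] that by (rule orthonormal_mono)
  define b where "b k = (hardy_norm (residual ?B k F))\<^sup>2" for k
  define a where "a k = cmod (hardy_inner F (?B k))" for k
  have "b m \<le> M\<^sup>2 / (real m + 1)"
  proof (rule greedy_recursion[OF assms(1)])
    have "residual ?B 0 F = F" by (simp add: residual_def fun_eq_iff)
    then show "b 0 \<le> M\<^sup>2"
      using power_mono[OF hardy_class_norm_le[OF assms(3)] hardy_norm_nonneg] by (simp add: b_def)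
    show "0 \<le> b k" for k by (simp add: b_def)
    fix k assume k: "k < m"
    have Bk: "orthonormal ?B k" and BS: "orthonormal ?B (Suc k)" using k by (auto intro: B)
    note R = residual_hardy_closure[OF Bk V]
    \<comment> \<open>The sums in Bessel's identity for k and k + 1 differ by the one new
      coefficient.\<close>
    show "b (Suc k) = b k - (a k)\<^sup>2"
      unfolding b_def a_def residual_norm_sq[OF Bk V] residual_norm_sq[OF BS V] by simp
    have "hardy_inner (residual ?B k F) (residual ?B k F) = hardy_inner (residual ?B k F) F"
      by (rule hardy_inner_residual_right[OF Bk R V residual_orthogonal[OF Bk V]])
    moreover have "cmod (hardy_inner (residual ?B k F) (residual ?B k F)) = b k"
      by (simp add: hardy_inner_self[OF R] b_def norm_power)
    ultimately have "b k = cmod (hardy_inner (residual ?B k F) F)" by simp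
    also have "\<dots> \<le> M * a k"
    proof (rule hardy_class_inner_le[OF assms(3) R])
      fix u :: "complex ^ 'n" assume u: "u \<in> tube"
      \<comment> \<open>Updating z at k by its own value changes nothing, so the maximum in the
        selection principle is \<open>a k\<close>.\<close>
      have "trial_fun d z k (z k) = ?B k"
        using trial_fun_eq[OF assms(4) k, of d "z k"] basis_fun_eq[of d z k] by simp
      then show "cmod (hardy_inner (residual ?B k F) (normalized (kernel u))) \<le> a k"
        using residual_kernel_le_trial[OF assms(4) k u V, of d] assms(5) k u
        unfolding maximal_selection_def a_def by (metis order_trans)
    qed
    finally show "b k \<le> M * a k" .
  qed
  then have "hardy_norm (residual ?B m F) \<le> sqrt (M\<^sup>2 / (real m + 1))"
    unfolding b_def by (rule real_le_rsqrt)
  also have "\<dots> = M / sqrt (real m + 1)"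
    using assms(1) by (simp add: real_sqrt_divide)
  finally show ?thesis
    by (simp add: residual_def[abs_def] partial_sum_def)
qed

end
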